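(* Let $p$ and $q$ be primes with $q\equiv 1\pmod p$, let $G$ be isomorphic to $F_{p,q}$, the non-abelian group of order $pq$, and let $\Gamma=\mathcal{E}_c^-(G)$. Then $\mathrm{Spec}(\Gamma)=\{(0)^{q(p-2)},(-(p-1))^{q-1},((p-1)(q-1))^1\}$, $\mathrm{L\text{-}spec}(\Gamma)=\{(0)^1,((p-1)(q-1))^{q(p-2)},(q(p-1))^{q-1}\}$, $\mathrm{Q\text{-}spec}(\Gamma)=\{((p-1)(q-1))^{q(p-2)},((p-1)(q-2))^{q-1},(2(p-1)(q-1))^1\}$, and $E(\Gamma)=LE(\Gamma)=LE^+(\Gamma)=2(p-1)(q-1)$.
   Context: For elements $x,y$ of a group, $[x,y]=x^{-1}y^{-1}xy$, $[x,{}_1y]=[x,y]$ and $[x,{}_{k+1}y]=[[x,{}_ky],y]$ for $k\ge 1$. For a finite group $G$ with Fitting subgroup $F(G)$, $\mathcal{E}_c^-(G)$ is the simple undirected graph with vertex set $G\setminus F(G)$ in which distinct $x,y$ are adjacent iff $[x,{}_ky]\neq 1$ and $[y,{}_kx]\neq 1$ for all positive integers $k$. Explicitly, $F_{p,q}=\langle a,b\mid a^p=b^q=1,\ a^{-1}ba=b^r\rangle$ with $r^p\equiv 1\pmod q$ and $r\not\equiv 1\pmod q$. For a finite simple graph $\Gamma$ with vertex set $v(\Gamma)$, edge set $e(\Gamma)$, adjacency matrix $A$ and degree matrix $D$: $\mathrm{Spec}(\Gamma)$, $\mathrm{L\text{-}spec}(\Gamma)$, $\mathrm{Q\text{-}spec}(\Gamma)$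 are the multisets of eigenvalues of $A$, $D-A$, $D+A$ respectively; in $\{(\alpha_1)^{n_1},\dots,(\alpha_k)^{n_k}\}$ the exponent $n_i$ is the multiplicity of $\alpha_i$ (an exponent $0$ means the entry is absent). $E(\Gamma)=\sum_{\lambda\in \mathrm{Spec}(\Gamma)}|\lambda|$, $LE(\Gamma)=\sum_{\mu\in \mathrm{L\text{-}spec}(\Gamma)}\left|\mu-\frac{2|e(\Gamma)|}{|v(\Gamma)|}\right|$, $LE^+(\Gamma)=\sum_{\nu\in \mathrm{Q\text{-}spec}(\Gamma)}\left|\nu-\frac{2|e(\Gamma)|}{|v(\Gamma)|}\right|$, sums being with multiplicity. *)

theory Defs
  imports
    "HOL-Algebra.Coset"
    "HOL-Algebra.Generated_Groups"
    "HOL-Number_Theory.Cong"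
    "HOL-Computational_Algebra.Primes"
    "Jordan_Normal_Form.Char_Poly"
begin

section \<open>Group presentations\<close>

text \<open>A letter \<open>(x, True)\<close> stands for the generator \<open>x\<close>, and \<open>(x, False)\<close> for its formal inverse.
  The free group on all elements of the type \<open>'x\<close> consists of the words modulo cancellation.\<close>

type_synonym 'x word = "('x \<times> bool) list"

inductive word_eq :: "'x word \<Rightarrow> 'x word \<Rightarrow> bool" where
  refl: "word_eq u u"
| sym: "word_eq u v \<Longrightarrow> word_eq v u"
| trans: "word_eq u v \<Longrightarrow> word_eq v w \<Longrightarrow> word_eq u w"
| cancel: "word_eq (u @ [(x, s), (x, \<not> s)] @ v) (u @ v)"

definition word_class :: "'x word \<Rightarrow> 'x word set" where
  "word_class u = {v. word_eq u v}"

definition free_group :: "'x word set monoid" where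
  "free_group = \<lparr>carrier = range word_class,
     monoid.mult = (\<lambda>A B. \<Union>u\<in>A. \<Union>v\<in>B. word_class (u @ v)),
     one = word_class []\<rparr>"

definition free_gen :: "'x \<Rightarrow> 'x word set" where
  "free_gen x = word_class [(x, True)]"

definition normal_closure :: "('g, 'm) monoid_scheme \<Rightarrow> 'g set \<Rightarrow> 'g set" where
  "normal_closure G R = \<Inter> {N. N \<lhd> G \<and> R \<subseteq> N}"

definition presented_group :: "'x word set set \<Rightarrow> 'x word set set monoid" where
  "presented_group R = free_group Mod normal_closure free_group R"

datatype gen = Gen_a | Gen_b

text \<open>The group \<open>\<langle>a, b | a\<^sup>p = b\<^sup>q = 1, a\<^sup>-\<^sup>1 b a = b\<^sup>r\<rangle>\<close>.\<close>

definition F_pq :: "nat \<Rightarrow> nat \<Rightarrow> int \<Rightarrow> gen word set set monoid" where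
  "F_pq p q r = (let F = free_group; a = free_gen Gen_a; b = free_gen Gen_b in
     presented_group
       {a [^]\<^bsub>F\<^esub> p,
        b [^]\<^bsub>F\<^esub> q,
        inv\<^bsub>F\<^esub> a \<otimes>\<^bsub>F\<^esub> b \<otimes>\<^bsub>F\<^esub> a \<otimes>\<^bsub>F\<^esub> inv\<^bsub>F\<^esub> (b [^]\<^bsub>F\<^esub> r)})"


section \<open>Commutators and the Fitting subgroup\<close>

definition commutator :: "('g, 'm) monoid_scheme \<Rightarrow> 'g \<Rightarrow> 'g \<Rightarrow> 'g" where
  "commutator G x y = inv\<^bsub>G\<^esub> x \<otimes>\<^bsub>G\<^esub> inv\<^bsub>G\<^esub> y \<otimes>\<^bsub>G\<^esub> x \<otimes>\<^bsub>G\<^esub> y"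

text \<open>\<open>iter_commutator G x k y\<close> is \<open>[x, \<^sub>k y]\<close>. The recursion starts with \<open>[x, \<^sub>0 y] = x\<close>,
  which makes \<open>[x, \<^sub>1 y] = [x, y]\<close>.\<close>

primrec iter_commutator :: "('g, 'm) monoid_scheme \<Rightarrow> 'g \<Rightarrow> nat \<Rightarrow> 'g \<Rightarrow> 'g" where
  "iter_commutator G x 0 y = x"
| "iter_commutator G x (Suc k) y = commutator G (iter_commutator G x k y) y"

primrec lower_central :: "('g, 'm) monoid_scheme \<Rightarrow> nat \<Rightarrow> 'g set" where
  "lower_central G 0 = carrier G"
| "lower_central G (Suc n) =
     generate G {commutator G x y | x y. x \<in> lower_central G n \<and> y \<in> carrier G}"

definition nilpotent_group :: "('g, 'm) monoid_scheme \<Rightarrow> bool" where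
  "nilpotent_group G \<longleftrightarrow> group G \<and> (\<exists>n. lower_central G n = {\<one>\<^bsub>G\<^esub>})"

definition fitting_subgroup :: "('g, 'm) monoid_scheme \<Rightarrow> 'g set" where
  "fitting_subgroup G =
     generate G (\<Union> {N. N \<lhd> G \<and> nilpotent_group (G\<lparr>carrier := N\<rparr>)})"


section \<open>Simple graphs and their spectra\<close>

text \<open>The edges are two-element sets of vertices.\<close>

record 'v sgraph =
  vertices :: "'v set"
  edges :: "'v set set"

definition engel_graph :: "('g, 'm) monoid_scheme \<Rightarrow> 'g sgraph" where
  "engel_graph G = (let V = carrier G - fitting_subgroup G in
     \<lparr>vertices = V,
      edges = {{x, y} | x y. x \<in> V \<and> y \<in> V \<and> x \<noteq> y \<and>
        (\<forall>k\<ge>1. iter_commutator G x k y \<noteq> \<one>\<^bsub>G\<^esub> \<and> iter_commutator G y k x \<noteq> \<one>\<^bsub>G\<^esub>)}\<rparr>)"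

text \<open>Matrices are indexed by positions in an arbitrary enumeration of the (finite) vertex set;
  another enumeration conjugates them by a permutation matrix and leaves the spectra unchanged.\<close>

definition vertex_list :: "'v sgraph \<Rightarrow> 'v list" where
  "vertex_list \<Gamma> = (SOME vs. distinct vs \<and> set vs = vertices \<Gamma>)"

definition degree_of :: "'v sgraph \<Rightarrow> 'v \<Rightarrow> nat" where
  "degree_of \<Gamma> v = card {e \<in> edges \<Gamma>. v \<in> e}"

definition adjacency_mat :: "'v sgraph \<Rightarrow> real mat" where
  "adjacency_mat \<Gamma> = (let vs = vertex_list \<Gamma>; n = length vs in
     mat n n (\<lambda>(i, j). if {vs ! i, vs ! j} \<in> edges \<Gamma> then 1 else 0))"

definition degree_mat :: "'v sgraph \<Rightarrow> real mat" where
  "degree_mat \<Gamma> = (let vs = vertex_list \<Gamma>; n = length vs in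
     mat n n (\<lambda>(i, j). if i = j then real (degree_of \<Gamma> (vs ! i)) else 0))"

text \<open>The eigenvalues are counted with algebraic multiplicity. Only real ones are collected, which
  loses nothing for the real symmetric matrices considered here.\<close>

definition eigenvalue_mset :: "real mat \<Rightarrow> real multiset" where
  "eigenvalue_mset M = proots (char_poly M)"

definition Spec :: "'v sgraph \<Rightarrow> real multiset" where
  "Spec \<Gamma> = eigenvalue_mset (adjacency_mat \<Gamma>)"

definition L_spec :: "'v sgraph \<Rightarrow> real multiset" where
  "L_spec \<Gamma> = eigenvalue_mset (degree_mat \<Gamma> - adjacency_mat \<Gamma>)"

definition Q_spec :: "'v sgraph \<Rightarrow> real multiset" where
  "Q_spec \<Gamma> = eigenvalue_mset (degree_mat \<Gamma> + adjacency_mat \<Gamma>)"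

definition mean_degree :: "'v sgraph \<Rightarrow> real" where
  "mean_degree \<Gamma> = 2 * real (card (edges \<Gamma>)) / real (card (vertices \<Gamma>))"

definition energy :: "'v sgraph \<Rightarrow> real" where
  "energy \<Gamma> = (\<Sum>\<alpha>\<in>#Spec \<Gamma>. \<bar>\<alpha>\<bar>)"

definition laplacian_energy :: "'v sgraph \<Rightarrow> real" where
  "laplacian_energy \<Gamma> = (\<Sum>\<mu>\<in>#L_spec \<Gamma>. \<bar>\<mu> - mean_degree \<Gamma>\<bar>)"

definition signless_laplacian_energy :: "'v sgraph \<Rightarrow> real" where
  "signless_laplacian_energy \<Gamma> = (\<Sum>\<nu>\<in>#Q_spec \<Gamma>. \<bar>\<nu> - mean_degree \<Gamma>\<bar>)"

end

theory Submission
  imports Defs "HOL-Algebra.Multiplicative_Group"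
begin

text \<open>The group of order \<open>p q\<close> is identified with a group of affine maps \<open>z \<mapsto> s z + t\<close> on the residues
  modulo \<open>q\<close>. Its Fitting subgroup consists of the translations, and every other element has
  exactly one fixed point. Commutators are translations, and a map that is not a translation acts on the
  translations without fixed points, so two vertices are adjacent iff they do not commute, that
  is, iff their fixed points differ. Hence the graph is complete \<open>q\<close>-partite with parts of size
  \<open>p - 1\<close>. Its adjacency matrix is \<open>B (J - I) B\<^sup>T\<close> for the \<open>q\<close>-column incidence matrix \<open>B\<close> of
  the parts, and exchanging the factors in the characteristic polynomial reduces the spectra to
  those of \<open>J - I\<close>.\<close>


section \<open>Determinants and complete multipartite graphs\<close>

text \<open>The group is given only by generators and relations, so its order is itself something to
  prove. The relations bring every element to the form \<open>a^i b^j\<close>, which bounds the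
  group from above; the maps \<open>z \<mapsto> r z\<close> and \<open>z \<mapsto> z + 1\<close>
  satisfy the relations and have orders exactly \<open>p\<close> and \<open>q\<close>, which bounds
  it from below. Composing maps from left to right makes
  \<open>a\<^sup>-\<^sup>1 b a = b\<^sup>r\<close> hold without replacing \<open>r\<close> by its
  inverse. On the matrix side, the graph is regular, so all three matrices have the form
  \<open>c I + d A\<close> with \<open>A\<close> the adjacency matrix, and one characteristic
  polynomial covers them.\<close>

lemma det_weinstein_aronszajn:
  fixes y :: "'a :: idom"
  assumes B: "B \<in> carrier_mat n k" and C: "C \<in> carrier_mat k n"
  shows "y ^ k * det (y \<cdot>\<^sub>m 1\<^sub>m n - B * C) = y ^ n * det (y \<cdot>\<^sub>m 1\<^sub>m k - C * B)"
proof -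
  \<comment> \<open>The determinant of this block matrix is evaluated twice: multiplying by
    \<open>?L\<close> clears the block \<open>C\<close>, multiplying by \<open>?R\<close> clears the
    block \<open>B\<close>, and each product is block triangular. The factor \<open>y ^ k\<close> is
    \<open>det ?R\<close>.\<close>
  let ?M = "four_block_mat (y \<cdot>\<^sub>m 1\<^sub>m n) B C (1\<^sub>m k)"
  let ?L = "four_block_mat (1\<^sub>m n) (0\<^sub>m n k) (- C) (1\<^sub>m k)"
  let ?R = "four_block_mat (1\<^sub>m n) (- B) (0\<^sub>m k n) (y \<cdot>\<^sub>m 1\<^sub>m k)"
  have M: "?M \<in> carrier_mat (n + k) (n + k)" by (rule four_block_carrier_mat) auto
  have BC: "B * C \<in> carrier_mat n n" "C * B \<in> carrier_mat k k"
    "y \<cdot>\<^sub>m 1\<^sub>m n - B * C \<in> carrier_mat n n" "y \<cdot>\<^sub>m 1\<^sub>m k - C * B \<in> carrier_mat k k" using B C by auto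
  have "?M * ?L = four_block_mat (y \<cdot>\<^sub>m 1\<^sub>m n - B * C) B (0\<^sub>m k n) (1\<^sub>m k)"
    using B C by (subst mult_four_block_mat[of _ n n _ k _ k _ _ n _ k])
      (auto intro!: arg_cong4[where f = four_block_mat] simp: minus_add_uminus_mat[of _ n n] BC)
  moreover have "?L \<in> carrier_mat (n + k) (n + k)" by (rule four_block_carrier_mat) auto
  moreover have "det ?L = 1"
    using C by (subst det_four_block_mat_upper_right_zero[of _ n _ k]) auto
  ultimately have 1: "det ?M = det (y \<cdot>\<^sub>m 1\<^sub>m n - B * C)"
    using B BC det_mult[OF M, of ?L]
    by (simp add: det_four_block_mat_lower_left_zero[of _ n _ k])
  have "?M * ?R = four_block_mat (y \<cdot>\<^sub>m 1\<^sub>m n) (0\<^sub>m n k) C (y \<cdot>\<^sub>m 1\<^sub>m k - C * B)"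
    using B C by (subst mult_four_block_mat[of _ n n _ k _ k _ _ n _ k])
      (auto intro!: arg_cong4[where f = four_block_mat] simp: BC mult_smult_distrib[of _ _ k])
  moreover have "?R \<in> carrier_mat (n + k) (n + k)" by (rule four_block_carrier_mat) auto
  moreover have "det ?R = y ^ k"
    using B by (subst det_four_block_mat_lower_left_zero[of _ n _ k]) (auto simp: det_smult)
  ultimately have 2: "det ?M * y ^ k = y ^ n * det (y \<cdot>\<^sub>m 1\<^sub>m k - C * B)"
    using C BC det_mult[OF M, of ?R]
    by (simp add: det_four_block_mat_upper_right_zero[of _ n _ k] det_smult)
  show ?thesis using 1 2 by (simp add: mult.commute)
qed

text \<open>Each class has \<open>m\<close> elements, so \<open>C * B\<close> is
  \<open>m d (J - I)\<close> of size \<open>k\<close>, with \<open>J\<close> the all-ones matrix.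
  Its diagonal part is absorbed into \<open>z\<close>; what remains is the rank-one product
  \<open>B' * C'\<close>, and a second exchange of factors leaves a 1 by 1 determinant.\<close>

lemma det_complete_multipartite:
  fixes y d :: "'a :: idom" and g :: "nat \<Rightarrow> nat"
  assumes g: "\<And>i. i < n \<Longrightarrow> g i < k"
    and m: "\<And>u. u < k \<Longrightarrow> card {i. i < n \<and> g i = u} = m"
  defines "z \<equiv> y + of_nat m * d"
  shows "y ^ k * z * det (mat n n (\<lambda>(i, j). (if i = j then y else 0) - (if g i \<noteq> g j then d else 0)))
    = y ^ n * z ^ k * (z - of_nat (k * m) * d)"
proof -
  define B where "B = mat n k (\<lambda>(i, u). if g i = u then 1 else (0::'a))"
  define C where "C = mat k n (\<lambda>(u, j). if u \<noteq> g j then d else 0)"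
  define B' where "B' = mat k 1 (\<lambda>_. 1::'a)"
  define C' where "C' = mat 1 k (\<lambda>_. of_nat m * d)"
  have c: "B \<in> carrier_mat n k" "C \<in> carrier_mat k n" "B' \<in> carrier_mat k 1" "C' \<in> carrier_mat 1 k"
    by (auto simp: B_def C_def B'_def C'_def)
  have "(B * C) $$ (i, j) = (if g i \<noteq> g j then d else 0)" if "i < n" "j < n" for i j
  proof -
    have "(B * C) $$ (i, j) = (\<Sum>u<k. (if g i = u then 1 else 0) * (if u \<noteq> g j then d else 0))"
      using that by (simp add: B_def C_def scalar_prod_def atLeast0LessThan)
    also have "\<dots> = (\<Sum>u<k. if g i = u then (if u \<noteq> g j then d else 0) else 0)"
      by (intro sum.cong) auto
    finally show ?thesis using g[OF that(1)] by (simp add: sum.delta')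
  qed
  then have BC: "y \<cdot>\<^sub>m 1\<^sub>m n - B * C =
    mat n n (\<lambda>(i, j). (if i = j then y else 0) - (if g i \<noteq> g j then d else 0))"
    using c by (intro eq_matI) auto
  have "(C * B) $$ (u, v) = (if u \<noteq> v then of_nat m * d else 0)" if "u < k" "v < k" for u v
  proof -
    have "(C * B) $$ (u, v) = (\<Sum>j<n. (if u \<noteq> g j then d else 0) * (if g j = v then 1 else 0))"
      using that by (simp add: B_def C_def scalar_prod_def atLeast0LessThan)
    also have "\<dots> = (\<Sum>j<n. if g j = v then (if u \<noteq> v then d else 0) else 0)"
      by (intro sum.cong) auto
    also have "\<dots> = (\<Sum>j\<in>{j. j < n \<and> g j = v}. if u \<noteq> v then d else 0)"
      by (subst sum.inter_filter[symmetric]) (auto intro: sum.cong)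
    finally show ?thesis using m[OF that(2)] by simp
  qed
  then have CB: "y \<cdot>\<^sub>m 1\<^sub>m k - C * B = z \<cdot>\<^sub>m 1\<^sub>m k - B' * C'"
    using c by (intro eq_matI) (auto simp: z_def B'_def C'_def scalar_prod_def)
  have "det (z \<cdot>\<^sub>m 1\<^sub>m 1 - C' * B') = z - of_nat (k * m) * d"
    using c by (subst det_single) (auto simp: B'_def C'_def scalar_prod_def mult.assoc)
  with det_weinstein_aronszajn[OF c(3,4), of z]
  have "z * det (y \<cdot>\<^sub>m 1\<^sub>m k - C * B) = z ^ k * (z - of_nat (k * m) * d)"
    by (simp add: CB)
  with det_weinstein_aronszajn[OF c(1,2), of y] show ?thesis
    by (simp add: BC[symmetric] mult.assoc mult.left_commute)
qed

lemma char_poly_complete_multipartite: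
  fixes c d :: real and g :: "nat \<Rightarrow> nat"
  assumes g: "\<And>i. i < n \<Longrightarrow> g i < k"
    and m: "\<And>u. u < k \<Longrightarrow> card {i. i < n \<and> g i = u} = m"
    and k: "0 < k" "0 < m"
  defines "M \<equiv> mat n n (\<lambda>(i, j). (if i = j then c else 0) + (if g i \<noteq> g j then d else 0))"
  shows "char_poly M =
    [:- c, 1:] ^ (k * (m - 1)) * [:- (c - real m * d), 1:] ^ (k - 1) * [:- (c + (real k - 1) * real m * d), 1:]"
proof -
  have "{..<n} = (\<Union>u<k. {i. i < n \<and> g i = u})" using g by auto
  then have "n = card (\<Union>u<k. {i. i < n \<and> g i = u})" by (metis card_lessThan)
  also have "\<dots> = k * m"
    by (subst card_UN_disjoint) (auto simp: m)
  finally have n: "n = k * m" .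
  let ?y = "[:- c, 1:]" and ?z = "[:- (c - real m * d), 1:]"
  have cp: "char_poly_matrix M = mat n n (\<lambda>(i, j). (if i = j then ?y else 0) - (if g i \<noteq> g j then [:d:] else 0))"
    by (intro eq_matI) (auto simp: char_poly_matrix_def M_def)
  have z: "?y + of_nat m * [:d:] = ?z" by (simp add: of_nat_poly)
  have last: "?z - of_nat (k * m) * [:d:] = [:- (c + (real k - 1) * real m * d), 1:]"
    by (simp add: of_nat_poly algebra_simps)
  have "?y ^ k * ?z * char_poly M = ?y ^ n * ?z ^ k * [:- (c + (real k - 1) * real m * d), 1:]"
    using det_complete_multipartite[of n g k m ?y "[:d:]", OF g m] unfolding char_poly_def cp z last
    by blast
  also have "?y ^ n = ?y ^ k * ?y ^ (k * (m - 1))"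
    using k by (simp add: n power_add[symmetric] algebra_simps)
  also have "?z ^ k = ?z * ?z ^ (k - 1)" using k by (simp add: power_eq_if)
  finally have "(?y ^ k * ?z) * char_poly M = (?y ^ k * ?z) *
      (?y ^ (k * (m - 1)) * ?z ^ (k - 1) * [:- (c + (real k - 1) * real m * d), 1:])"
    by (simp only: mult.assoc mult.left_commute)
  \<comment> \<open>As a polynomial this factor is nonzero and can be cancelled, whereas its values
    at \<open>c\<close> and at \<open>c - real m * d\<close> vanish. This is why the determinant
    identity is used over polynomials and not pointwise.\<close>
  moreover have "?y ^ k * ?z \<noteq> 0" by (simp del: mult_pCons_left mult_pCons_right)
  ultimately show ?thesis using mult_left_cancel by blast
qed

lemma eigenvalue_mset_complete_multipartite:
  fixes c d :: real and g :: "nat \<Rightarrow> nat"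
  assumes "\<And>i. i < n \<Longrightarrow> g i < k"
    and "\<And>u. u < k \<Longrightarrow> card {i. i < n \<and> g i = u} = m"
    and "0 < k" "0 < m"
  shows "eigenvalue_mset (mat n n (\<lambda>(i, j). (if i = j then c else 0) + (if g i \<noteq> g j then d else 0))) =
    replicate_mset (k * (m - 1)) c + replicate_mset (k - 1) (c - real m * d) + {# c + (real k - 1) * real m * d #}"
  unfolding eigenvalue_mset_def
proof -
  let ?M = "mat n n (\<lambda>(i, j). (if i = j then c else 0) + (if g i \<noteq> g j then d else 0))"
  let ?z = "c - real m * d" and ?w = "c + (real k - 1) * real m * d"
  have "char_poly ?M = [:- c, 1:] ^ (k * (m - 1)) * [:- ?z, 1:] ^ (k - 1) * [:- ?w, 1:]"
    by (rule char_poly_complete_multipartite) (fact assms)+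
  also have "proots \<dots> = proots ([:- c, 1:] ^ (k * (m - 1))) + proots ([:- ?z, 1:] ^ (k - 1)) + proots [:- ?w, 1:]"
    by (subst proots_mult; (subst proots_mult)?)
      (simp_all del: mult_pCons_left mult_pCons_right)
  finally show "proots (char_poly ?M) = replicate_mset (k * (m - 1)) c + replicate_mset (k - 1) ?z + {# ?w #}"
    by (simp add: proots_power)
qed

section \<open>Spectra and energies of complete multipartite graphs with equal parts\<close>

lemma sum_degree_of:
  assumes "finite (vertices \<Gamma>)" and E: "\<And>e. e \<in> edges \<Gamma> \<Longrightarrow> e \<subseteq> vertices \<Gamma> \<and> card e = 2"
  shows "(\<Sum>v\<in>vertices \<Gamma>. degree_of \<Gamma> v) = 2 * card (edges \<Gamma>)"
proof -
  have fin: "finite (edges \<Gamma>)"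
    by (rule finite_subset[of _ "Pow (vertices \<Gamma>)"]) (use assms in auto)
  have "card {v \<in> vertices \<Gamma>. v \<in> e} = 2" if "e \<in> edges \<Gamma>" for e
  proof -
    have "{v \<in> vertices \<Gamma>. v \<in> e} = e" using E[OF that] by auto
    then show ?thesis using E[OF that] by simp
  qed
  then show ?thesis unfolding degree_of_def
    using sum_multicount[OF assms(1) fin, of "\<lambda>v e. v \<in> e" 2] by (simp add: mult.commute)
qed

locale complete_multipartite =
  fixes \<Gamma> :: "'v sgraph" and f :: "'v \<Rightarrow> nat" and k m :: nat
  assumes edges: "edges \<Gamma> = {{x, y} | x y. x \<in> vertices \<Gamma> \<and> y \<in> vertices \<Gamma> \<and> f x \<noteq> f y}"
    and part: "\<And>v. v \<in> vertices \<Gamma> \<Longrightarrow> f v < k"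
    and card_part: "\<And>u. u < k \<Longrightarrow> card {v \<in> vertices \<Gamma>. f v = u} = m"
    and pos: "0 < k" "0 < m"
begin

lemma vertices_eq: "vertices \<Gamma> = (\<Union>u<k. {v \<in> vertices \<Gamma>. f v = u})"
  using part by auto

text \<open>An infinite set has \<open>card\<close> 0, so a part of positive size \<open>m\<close>
  is finite. This is where finiteness of the graph comes from.\<close>

lemma finite_part: "u < k \<Longrightarrow> finite {v \<in> vertices \<Gamma>. f v = u}"
  using card_part[of u] pos by (intro card_ge_0_finite) auto

lemma finite_vertices: "finite (vertices \<Gamma>)"
  by (subst vertices_eq) (use finite_part in auto)

lemma card_vertices: "card (vertices \<Gamma>) = k * m"
  by (subst vertices_eq, subst card_UN_disjoint) (use finite_part card_part in auto)

lemma edge_iff: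
  assumes "x \<in> vertices \<Gamma>" "y \<in> vertices \<Gamma>"
  shows "{x, y} \<in> edges \<Gamma> \<longleftrightarrow> f x \<noteq> f y"
  using assms unfolding edges by (auto simp: doubleton_eq_iff)

text \<open>The edges at \<open>v\<close> correspond to the vertices outside the part of
  \<open>v\<close> by \<open>w \<mapsto> {v, w}\<close>.\<close>

lemma degree_of_eq:
  assumes "v \<in> vertices \<Gamma>"
  shows "degree_of \<Gamma> v = (k - 1) * m"
proof -
  have "{e \<in> edges \<Gamma>. v \<in> e} = (\<lambda>w. {v, w}) ` (vertices \<Gamma> - {w \<in> vertices \<Gamma>. f w = f v})"
  proof (intro equalityI subsetI)
    fix e assume "e \<in> {e \<in> edges \<Gamma>. v \<in> e}"
    then obtain x y where "e = {x, y}" "x \<in> vertices \<Gamma>" "y \<in> vertices \<Gamma>" "f x \<noteq> f y" "v = x \<or> v = y"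
      unfolding edges by auto
    then show "e \<in> (\<lambda>w. {v, w}) ` (vertices \<Gamma> - {w \<in> vertices \<Gamma>. f w = f v})"
      by (auto simp: insert_commute)
  qed (use assms in \<open>auto simp: edge_iff\<close>)
  moreover have "inj_on (\<lambda>w. {v, w}) A" for A
    by (auto simp: inj_on_def doubleton_eq_iff)
  ultimately have "degree_of \<Gamma> v = card (vertices \<Gamma> - {w \<in> vertices \<Gamma>. f w = f v})"
    unfolding degree_of_def by (simp add: card_image)
  also have "\<dots> = k * m - m"
    using part[OF assms] by (subst card_Diff_subset) (auto simp: finite_part card_vertices card_part)
  finally show ?thesis by (simp add: algebra_simps)
qed

lemma mean_degree_eq: "mean_degree \<Gamma> = (real k - 1) * real m"
proof -
  have "2 * card (edges \<Gamma>) = card (vertices \<Gamma>) * ((k - 1) * m)"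
    by (subst sum_degree_of[symmetric])
      (auto simp: finite_vertices degree_of_eq edges card_insert_if)
  from arg_cong[OF this, of real]
  have "2 * real (card (edges \<Gamma>)) = real (card (vertices \<Gamma>)) * ((real k - 1) * real m)"
    using pos by (simp add: of_nat_diff)
  then show ?thesis using pos by (simp add: mean_degree_def card_vertices)
qed

lemma vertex_list: "distinct (vertex_list \<Gamma>)" "set (vertex_list \<Gamma>) = vertices \<Gamma>"
proof -
  have "\<exists>vs. distinct vs \<and> set vs = vertices \<Gamma>"
    using finite_distinct_list[OF finite_vertices] by auto
  from someI_ex[OF this] show "distinct (vertex_list \<Gamma>)" "set (vertex_list \<Gamma>) = vertices \<Gamma>"
    unfolding vertex_list_def by auto
qed

text \<open>The arbitrary choice made by \<open>vertex_list\<close> has no effect: only the part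
  sizes enter the spectrum, and the enumeration carries them from vertices to positions.\<close>

lemma eigenvalue_mset_eq:
  defines "vs \<equiv> vertex_list \<Gamma>"
  shows "eigenvalue_mset (mat (length vs) (length vs)
      (\<lambda>(i, j). (if i = j then c else 0) + (if f (vs ! i) \<noteq> f (vs ! j) then d else 0))) =
    replicate_mset (k * (m - 1)) c + replicate_mset (k - 1) (c - real m * d) + {# c + (real k - 1) * real m * d #}"
proof (rule eigenvalue_mset_complete_multipartite)
  show "f (vs ! i) < k" if "i < length vs" for i
    using that vertex_list nth_mem[OF that] by (auto simp: vs_def intro: part)
  show "card {i. i < length vs \<and> f (vs ! i) = u} = m" if "u < k" for u
  proof -
    have "(!) vs ` {i. i < length vs \<and> f (vs ! i) = u} = {v \<in> vertices \<Gamma>. f v = u}"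
      using vertex_list by (auto simp: vs_def in_set_conv_nth simp flip: vertex_list(2))
    moreover have "inj_on ((!) vs) {i. i < length vs \<and> f (vs ! i) = u}"
      using vertex_list(1) by (auto simp: inj_on_def vs_def nth_eq_iff_index_eq)
    ultimately show ?thesis using card_part[OF that] card_image[symmetric] by fastforce
  qed
qed (rule pos)+

lemma nth_vertex_list: "i < length (vertex_list \<Gamma>) \<Longrightarrow> vertex_list \<Gamma> ! i \<in> vertices \<Gamma>"
  using nth_mem[of i "vertex_list \<Gamma>"] by (simp add: vertex_list)

lemma Spec_eq: "Spec \<Gamma> = replicate_mset (k * (m - 1)) 0 + replicate_mset (k - 1) (- real m)
    + {# (real k - 1) * real m #}"
proof -
  let ?vs = "vertex_list \<Gamma>"
  \<comment> \<open>The vacuous \<open>if i = j then 0 else 0\<close> casts the matrix into the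
    common template with \<open>c = 0\<close> and \<open>d = 1\<close>; the Laplacians below take
    the degree for \<open>c\<close> and -1 or 1 for \<open>d\<close>.\<close>
  have "adjacency_mat \<Gamma> = mat (length ?vs) (length ?vs)
    (\<lambda>(i, j). (if i = j then 0 else 0) + (if f (?vs ! i) \<noteq> f (?vs ! j) then 1 else 0))"
    unfolding adjacency_mat_def Let_def by (rule eq_matI) (auto simp: edge_iff nth_vertex_list)
  then show ?thesis by (simp only: Spec_def eigenvalue_mset_eq) simp
qed

lemma L_spec_eq: "L_spec \<Gamma> = {# 0 #} + replicate_mset (k * (m - 1)) ((real k - 1) * real m)
    + replicate_mset (k - 1) (real k * real m)"
proof -
  let ?vs = "vertex_list \<Gamma>"
  have "degree_mat \<Gamma> - adjacency_mat \<Gamma> = mat (length ?vs) (length ?vs)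
    (\<lambda>(i, j). (if i = j then (real k - 1) * real m else 0) + (if f (?vs ! i) \<noteq> f (?vs ! j) then - 1 else 0))"
    unfolding adjacency_mat_def degree_mat_def Let_def using pos
    by (intro eq_matI) (auto simp: edge_iff nth_vertex_list degree_of_eq of_nat_diff)
  then show ?thesis by (simp only: L_spec_def eigenvalue_mset_eq) (simp add: algebra_simps)
qed

lemma Q_spec_eq: "Q_spec \<Gamma> = replicate_mset (k * (m - 1)) ((real k - 1) * real m)
    + replicate_mset (k - 1) ((real k - 2) * real m) + {# 2 * (real k - 1) * real m #}"
proof -
  let ?vs = "vertex_list \<Gamma>"
  have "degree_mat \<Gamma> + adjacency_mat \<Gamma> = mat (length ?vs) (length ?vs)
    (\<lambda>(i, j). (if i = j then (real k - 1) * real m else 0) + (if f (?vs ! i) \<noteq> f (?vs ! j) then 1 else 0))"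
    unfolding adjacency_mat_def degree_mat_def Let_def using pos
    by (intro eq_matI) (auto simp: edge_iff nth_vertex_list degree_of_eq of_nat_diff)
  then show ?thesis by (simp only: Q_spec_def eigenvalue_mset_eq) (simp add: algebra_simps)
qed

lemma energy_eq: "energy \<Gamma> = 2 * (real k - 1) * real m"
  using pos by (simp add: energy_def Spec_eq of_nat_diff abs_mult)

text \<open>The eigenvalue of multiplicity \<open>k * (m - 1)\<close> is the mean degree and
  contributes nothing. The eigenvalue 0 contributes the mean degree, and each of the other
  \<open>k - 1\<close> contributes \<open>m\<close>; the signless case has the same
  distances.\<close>

lemma laplacian_energy_eq: "laplacian_energy \<Gamma> = 2 * (real k - 1) * real m"
proof -
  have "\<bar>real k * real m - (real k - 1) * real m\<bar> = real m" by (simp add: algebra_simps)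
  then show ?thesis using pos
    by (simp add: laplacian_energy_def L_spec_eq mean_degree_eq of_nat_diff abs_mult)
qed

lemma signless_laplacian_energy_eq: "signless_laplacian_energy \<Gamma> = 2 * (real k - 1) * real m"
proof -
  have "\<bar>(real k - 2) * real m - (real k - 1) * real m\<bar> = real m"
    "\<bar>2 * (real k - 1) * real m - (real k - 1) * real m\<bar> = (real k - 1) * real m"
    using pos by (simp_all add: algebra_simps)
  then show ?thesis using pos
    by (simp add: signless_laplacian_energy_def Q_spec_eq mean_degree_eq of_nat_diff)
qed

end

section \<open>Free groups and presentations\<close>

lemma word_eq_append: "word_eq u v \<Longrightarrow> word_eq (w @ u @ w') (w @ v @ w')"
proof (induction rule: word_eq.induct)
  case (cancel u x s v)
  then show ?case using word_eq.cancel[of "w @ u" x s "v @ w'"] by simp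
next
  case (trans u v w)
  show ?case by (rule word_eq.trans[OF trans.IH])
next
  case (sym u v)
  show ?case by (rule word_eq.sym[OF sym.IH])
qed (rule word_eq.refl)

lemma word_eq_append_cong: "word_eq u u' \<Longrightarrow> word_eq v v' \<Longrightarrow> word_eq (u @ v) (u' @ v')"
  using word_eq_append[of u u' "[]" v] word_eq_append[of v v' u' "[]"] by simp (rule word_eq.trans)

lemma word_class_eq_iff: "word_class u = word_class v \<longleftrightarrow> word_eq u v"
proof
  assume "word_class u = word_class v"
  then have "v \<in> word_class u" by (simp add: word_class_def word_eq.refl)
  then show "word_eq u v" by (simp add: word_class_def)
next
  assume "word_eq u v"
  then have "word_eq u w \<longleftrightarrow> word_eq v w" for w by (blast intro: word_eq.sym word_eq.trans)
  then show "word_class u = word_class v" by (simp add: word_class_def)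
qed

lemma in_word_class: "u \<in> word_class u"
  by (simp add: word_class_def word_eq.refl)

lemma carrier_free_group: "carrier free_group = range word_class"
  by (simp add: free_group_def)

lemma one_free_group: "\<one>\<^bsub>free_group\<^esub> = word_class []"
  by (simp add: free_group_def)

text \<open>The product in \<open>free_group\<close> is a union over all pairs of representatives.
  Cancellation is compatible with concatenation, so all the united classes coincide.\<close>

lemma mult_free_group: "word_class u \<otimes>\<^bsub>free_group\<^esub> word_class v = word_class (u @ v)"
proof -
  have "word_class (u' @ v') = word_class (u @ v)" if "u' \<in> word_class u" "v' \<in> word_class v" for u' v'
    unfolding word_class_eq_iff
    by (rule word_eq.sym, rule word_eq_append_cong) (use that in \<open>simp_all add: word_class_def\<close>)
  moreover have "word_class u \<noteq> {}" "word_class v \<noteq> {}" using in_word_class by blast+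
  ultimately show ?thesis by (simp add: free_group_def)
qed

lemma word_eq_letter_cancel: "word_eq [(x, \<not> s), (x, s)] []"
  using word_eq.cancel[of "[]" x "\<not> s" "[]"] by simp

lemma word_eq_rev_cancel: "word_eq (rev (map (\<lambda>(x, s). (x, \<not> s)) u) @ u) []"
proof (induction u)
  case (Cons l u)
  obtain x s where l: "l = (x, s)" by fastforce
  let ?r = "rev (map (\<lambda>(x, s). (x, \<not> s)) u)"
  have "word_eq (?r @ [(x, \<not> s), (x, s)] @ u) (?r @ [] @ u)"
    by (rule word_eq_append[OF word_eq_letter_cancel])
  with Cons show ?case by (simp add: l) (rule word_eq.trans)
qed (simp add: word_eq.refl)

lemma group_free_group: "group free_group"
proof (rule groupI)
  fix A assume "A \<in> carrier (free_group :: 'x word set monoid)"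
  then obtain u where "A = word_class u" by (auto simp: carrier_free_group)
  then show "\<exists>B\<in>carrier free_group. B \<otimes>\<^bsub>free_group\<^esub> A = \<one>\<^bsub>free_group\<^esub>"
    by (auto simp: carrier_free_group mult_free_group one_free_group word_class_eq_iff
        intro!: word_eq_rev_cancel)
qed (auto simp: carrier_free_group mult_free_group one_free_group)

interpretation FG: group "free_group :: 'x word set monoid"
  by (rule group_free_group)

lemma free_gen_closed [simp]: "free_gen x \<in> carrier free_group"
  by (simp add: free_gen_def carrier_free_group)

lemma inv_free_gen: "inv\<^bsub>free_group\<^esub> (free_gen x) = word_class [(x, False)]"
  using word_eq_letter_cancel[of x True]
  by (intro FG.inv_equality)
    (auto simp: free_gen_def carrier_free_group mult_free_group one_free_group word_class_eq_iff)

lemma free_group_induct [consumes 1, case_names one gen inv]: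
  assumes "A \<in> carrier free_group"
    and one: "P \<one>\<^bsub>free_group\<^esub>"
    and gen: "\<And>x A. A \<in> carrier free_group \<Longrightarrow> P A \<Longrightarrow> P (free_gen x \<otimes>\<^bsub>free_group\<^esub> A)"
    and inv: "\<And>x A. A \<in> carrier free_group \<Longrightarrow> P A \<Longrightarrow> P (inv\<^bsub>free_group\<^esub> (free_gen x) \<otimes>\<^bsub>free_group\<^esub> A)"
  shows "P A"
proof -
  have "P (word_class u)" for u
  proof (induction u)
    case Nil
    then show ?case using one by (simp add: one_free_group)
  next
    case (Cons l u)
    obtain x s where l: "l = (x, s)" by fastforce
    have "word_class (l # u) = (if s then free_gen x else inv\<^bsub>free_group\<^esub> (free_gen x)) \<otimes>\<^bsub>free_group\<^esub> word_class u"
      by (simp add: l inv_free_gen mult_free_group) (simp add: free_gen_def mult_free_group)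
    then show ?case using Cons gen[of "word_class u" x] inv[of "word_class u" x]
      by (simp add: carrier_free_group)
  qed
  with assms(1) show ?thesis by (auto simp: carrier_free_group)
qed

section \<open>Universal property of the free group\<close>

definition word_eval :: "('g, 'm) monoid_scheme \<Rightarrow> ('x \<Rightarrow> 'g) \<Rightarrow> 'x word \<Rightarrow> 'g" where
  "word_eval G g u = foldr (\<lambda>(x, s) y. (if s then g x else inv\<^bsub>G\<^esub> (g x)) \<otimes>\<^bsub>G\<^esub> y) u \<one>\<^bsub>G\<^esub>"

context group
begin

lemma word_eval_closed: "range g \<subseteq> carrier G \<Longrightarrow> word_eval G g u \<in> carrier G"
  by (induction u) (auto simp: word_eval_def image_subset_iff)

lemma word_eval_append:
  "range g \<subseteq> carrier G \<Longrightarrow> word_eval G g (u @ v) = word_eval G g u \<otimes> word_eval G g v"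
proof (induction u)
  case Nil
  then show ?case using word_eval_closed[of g v] by (simp add: word_eval_def)
next
  case (Cons l u)
  then show ?case using word_eval_closed[of g u] word_eval_closed[of g v]
    by (auto simp: word_eval_def m_assoc image_subset_iff split: prod.splits)
qed

lemma word_eval_cong:
  assumes "word_eq u v" and g: "range g \<subseteq> carrier G"
  shows "word_eval G g u = word_eval G g v"
  using assms(1)
proof induction
  case (cancel u x s v)
  have "word_eval G g [(x, s), (x, \<not> s)] = \<one>"
    using g by (auto simp: word_eval_def image_subset_iff)
  then show ?case using word_eval_closed[OF g] by (simp only: word_eval_append[OF g]) simp
qed auto

text \<open>Evaluation is constant on cancellation classes, so the representative picked by
  \<open>SOME\<close> does not influence the value.\<close>

lemma free_group_hom:
  assumes g: "range g \<subseteq> carrier G"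
  obtains h where "h \<in> hom free_group G" "\<And>x. h (free_gen x) = g x"
proof
  let ?h = "\<lambda>A. word_eval G g (SOME u. u \<in> A)"
  have h: "?h (word_class u) = word_eval G g u" for u
  proof -
    have "(SOME v. v \<in> word_class u) \<in> word_class u"
      using in_word_class by (rule someI)
    then show ?thesis by (intro word_eval_cong[OF word_eq.sym g]) (simp add: word_class_def)
  qed
  show "?h \<in> hom free_group G"
    by (rule homI) (auto simp: carrier_free_group mult_free_group h word_eval_closed[OF g] word_eval_append[OF g])
  show "?h (free_gen x) = g x" for x
    unfolding free_gen_def h using g by (auto simp: word_eval_def image_subset_iff)
qed

section \<open>Normal closures and presented groups\<close>

lemma normal_closure_normal:
  assumes "R \<subseteq> carrier G"
  shows "normal_closure G R \<lhd> G"
proof -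
  let ?S = "{N. N \<lhd> G \<and> R \<subseteq> N}"
  \<comment> \<open>The whole group belongs to the family, so the intersection is not over the empty
    set.\<close>
  have "carrier G \<lhd> G" by (simp add: normal_inv_iff subgroup_self)
  then have ne: "?S \<noteq> {}" using assms by auto
  have "subgroup (\<Inter> ?S) G"
    by (rule subgroups_Inter) (use ne normal_imp_subgroup in auto)
  then show ?thesis unfolding normal_closure_def normal_inv_iff
    by (auto simp: normal_inv_iff)
qed

lemma subset_normal_closure: "R \<subseteq> normal_closure G R"
  by (auto simp: normal_closure_def)

end

lemma (in group_hom) normal_closure_subset_kernel:
  assumes "R \<subseteq> kernel G H h"
  shows "normal_closure G R \<subseteq> kernel G H h"
  using assms normal_kernel by (auto simp: normal_closure_def)

definition presented_gen :: "'x word set set \<Rightarrow> 'x \<Rightarrow> 'x word set set" where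
  "presented_gen R x = normal_closure free_group R #>\<^bsub>free_group\<^esub> free_gen x"

context
  fixes R :: "'x word set set"
  assumes R: "R \<subseteq> carrier free_group"
begin

interpretation N: normal "normal_closure free_group R" "free_group :: 'x word set monoid"
  by (rule FG.normal_closure_normal[OF R])

lemma group_presented_group: "group (presented_group R)"
  unfolding presented_group_def by (rule N.factorgroup_is_group)

lemma presentation_hom:
  obtains \<pi> where "\<pi> \<in> hom free_group (presented_group R)"
    "\<pi> ` carrier free_group = carrier (presented_group R)"
    "\<And>w. w \<in> R \<Longrightarrow> \<pi> w = \<one>\<^bsub>presented_group R\<^esub>"
    "\<And>x. \<pi> (free_gen x) = presented_gen R x"
proof
  let ?\<pi> = "\<lambda>A. normal_closure free_group R #>\<^bsub>free_group\<^esub> A"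
  show "?\<pi> \<in> hom free_group (presented_group R)"
    unfolding presented_group_def by (rule N.r_coset_hom_Mod)
  show "?\<pi> ` carrier free_group = carrier (presented_group R)"
    by (simp add: presented_group_def carrier_FactGroup)
  show "?\<pi> w = \<one>\<^bsub>presented_group R\<^esub>" if "w \<in> R" for w
    using that FG.subset_normal_closure R N.subgroup_axioms
    by (simp add: presented_group_def) (rule FG.coset_join2, auto)
qed (simp add: presented_gen_def)

lemma presented_gen_closed: "presented_gen R x \<in> carrier (presented_group R)"
  by (simp add: presented_gen_def presented_group_def carrier_FactGroup)

text \<open>Word induction transported along the surjection from the free group. It will show that a
  set containing 1 and closed under left multiplication by the generators and their inverses is
  everything.\<close>

lemma presented_group_induct [consumes 1, case_names one gen inv]:
  assumes "y \<in> carrier (presented_group R)"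
    and one: "P \<one>\<^bsub>presented_group R\<^esub>"
    and gen: "\<And>x y. y \<in> carrier (presented_group R) \<Longrightarrow> P y \<Longrightarrow> P (presented_gen R x \<otimes>\<^bsub>presented_group R\<^esub> y)"
    and inv: "\<And>x y. y \<in> carrier (presented_group R) \<Longrightarrow> P y \<Longrightarrow> P (inv\<^bsub>presented_group R\<^esub> (presented_gen R x) \<otimes>\<^bsub>presented_group R\<^esub> y)"
  shows "P y"
proof -
  obtain \<pi> where \<pi>: "\<pi> \<in> hom free_group (presented_group R)"
    "\<pi> ` carrier free_group = carrier (presented_group R)"
    "\<And>w. w \<in> R \<Longrightarrow> \<pi> w = \<one>\<^bsub>presented_group R\<^esub>"
    "\<And>x. \<pi> (free_gen x) = presented_gen R x"
    by (rule presentation_hom) (rule that)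
  interpret group_hom free_group "presented_group R" \<pi>
    using \<pi>(1) group_presented_group group_free_group by (simp add: group_hom_def group_hom_axioms_def)
  have "P (\<pi> A)" if "A \<in> carrier free_group" for A
    using that
  proof (induction rule: free_group_induct)
    case one
    then show ?case using assms(2) by simp
  next
    case (gen x A)
    then show ?case using assms(3)[of "\<pi> A" x] by (simp add: \<pi>(4))
  next
    case (inv x A)
    then show ?case using assms(4)[of "\<pi> A" x] by (simp add: \<pi>(4))
  qed
  then show ?thesis using assms(1) unfolding \<pi>(2)[symmetric] by auto
qed

text \<open>Von Dyck's theorem: the kernel of \<open>h\<close> is normal and contains the relators,
  hence also their normal closure, so \<open>h\<close> is constant on its cosets.\<close>

lemma presented_group_hom:
  assumes "h \<in> hom free_group H" "group H" "\<And>w. w \<in> R \<Longrightarrow> h w = \<one>\<^bsub>H\<^esub>"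
  obtains \<phi> where "\<phi> \<in> hom (presented_group R) H" "\<And>x. \<phi> (presented_gen R x) = h (free_gen x)"
proof -
  interpret group_hom free_group H h
    using assms group_free_group by (simp add: group_hom_def group_hom_axioms_def)
  have sub: "normal_closure free_group R \<subseteq> kernel free_group H h"
    using assms(3) R by (intro normal_closure_subset_kernel) (auto simp: kernel_def)
  obtain \<phi> where \<phi>: "\<phi> \<in> hom (free_group Mod normal_closure free_group R) H"
    "\<And>A. A \<in> carrier free_group \<Longrightarrow> \<phi> (normal_closure free_group R #>\<^bsub>free_group\<^esub> A) = h A"
  proof (rule FactGroup_universal[OF assms(1) N.normal_axioms])
    fix A B assume AB: "A \<in> carrier free_group" "B \<in> carrier free_group"
      and "normal_closure free_group R #>\<^bsub>free_group\<^esub> A = normal_closure free_group R #>\<^bsub>free_group\<^esub> B"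
    then have "A \<in> normal_closure free_group R #>\<^bsub>free_group\<^esub> B"
      using FG.rcos_self[of A, OF _ N.subgroup_axioms] by simp
    then obtain n where "n \<in> normal_closure free_group R" "A = n \<otimes>\<^bsub>free_group\<^esub> B"
      by (auto simp: r_coset_def)
    then show "h A = h B" using sub AB by (auto simp: kernel_def)
  qed blast
  show ?thesis
    by (rule that[of \<phi>]) (use \<phi> in \<open>simp_all add: presented_group_def presented_gen_def\<close>)
qed

end

section \<open>The affine group modulo a prime\<close>

text \<open>A pair \<open>(s, t)\<close> stands for the affine map \<open>z \<mapsto> s z + t\<close> on the residues modulo \<open>q\<close>;
  products are composed from left to right.\<close>

definition affine_group :: "int \<Rightarrow> (int \<times> int) monoid" where
  "affine_group q = \<lparr>carrier = {1..<q} \<times> {0..<q},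
     monoid.mult = (\<lambda>(s, t) (s', t'). (s * s' mod q, (s' * t + t') mod q)), one = (1, 0)\<rparr>"

lemma affine_group_simps:
  "carrier (affine_group q) = {1..<q} \<times> {0..<q}"
  "(s, t) \<otimes>\<^bsub>affine_group q\<^esub> (s', t') = (s * s' mod q, (s' * t + t') mod q)"
  "\<one>\<^bsub>affine_group q\<^esub> = (1, 0)"
  by (simp_all add: affine_group_def)

lemma mod_in_units:
  fixes q s :: int
  assumes "prime q" "\<not> q dvd s"
  shows "s mod q \<in> {1..<q}"
proof -
  have "s mod q \<noteq> 0" using assms(2) by (simp add: dvd_eq_mod_eq_0)
  moreover have "0 \<le> s mod q" "s mod q < q" using prime_gt_0_int[OF assms(1)] by simp_all
  ultimately show ?thesis by simp
qed

lemma unit_not_dvd: "s \<in> {1..<q} \<Longrightarrow> \<not> q dvd s" for q s :: int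
  using zdvd_not_zless by auto

lemma group_affine_group:
  assumes q: "prime q"
  shows "group (affine_group q)"
proof (rule groupI)
  have q1: "1 < q" using q by (rule prime_gt_1_int)
  show "\<one>\<^bsub>affine_group q\<^esub> \<in> carrier (affine_group q)"
    using q1 by (simp add: affine_group_simps)
  fix x y z assume x: "x \<in> carrier (affine_group q)"
  obtain s t where xe: "x = (s, t)" by fastforce
  have s: "\<not> q dvd s" using x unit_not_dvd by (auto simp: xe affine_group_simps)
  show "\<one>\<^bsub>affine_group q\<^esub> \<otimes>\<^bsub>affine_group q\<^esub> x = x"
    using x by (auto simp: xe affine_group_simps)
  show "\<exists>y\<in>carrier (affine_group q). y \<otimes>\<^bsub>affine_group q\<^esub> x = \<one>\<^bsub>affine_group q\<^esub>"
  proof -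
    have "coprime s q" using prime_imp_coprime[OF q s] by (simp add: coprime_commute)
    then obtain s' where s': "[s * s' = 1] (mod q)" using cong_solve_coprime_int by blast
    then have "\<not> q dvd s * s'" using q1 by (simp add: cong_dvd_iff cong_def dvd_eq_mod_eq_0)
    then have "\<not> q dvd s'" by (auto intro: dvd_mult)
    \<comment> \<open>Solving \<open>w = s z + t\<close> for \<open>z\<close> gives
      \<open>z = s' w - s' t\<close>, the inverse affine map.\<close>
    then have "(s' mod q, - (t * s') mod q) \<in> carrier (affine_group q)"
      using mod_in_units[OF q] q1 by (auto simp: affine_group_simps)
    moreover have "(s * (- (t * s') mod q) + t) mod q = 0"
    proof -
      have "[s * (- (t * s') mod q) + t = s * (- (t * s')) + t] (mod q)"
        by (intro cong_add cong_mult cong_refl) (simp add: cong_def)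
      also have "s * (- (t * s')) + t = t - t * (s * s')" by (simp add: algebra_simps)
      also have "[\<dots> = t - t * 1] (mod q)"
        using s' by (intro cong_diff cong_mult cong_refl)
      finally show ?thesis by (simp add: cong_def)
    qed
    moreover have "s' mod q * s mod q = 1"
      using s' q1 by (simp add: cong_def mod_simps mult.commute)
    ultimately show ?thesis by (intro bexI[of _ "(s' mod q, - (t * s') mod q)"]) (simp_all add: xe affine_group_simps)
  qed
  assume y: "y \<in> carrier (affine_group q)"
  obtain s' t' where ye: "y = (s', t')" by fastforce
  have s': "\<not> q dvd s'" using y unit_not_dvd by (auto simp: ye affine_group_simps)
  have "\<not> q dvd s * s'" using s s' q by (simp add: prime_dvd_mult_iff)
  then show "x \<otimes>\<^bsub>affine_group q\<^esub> y \<in> carrier (affine_group q)"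
    using mod_in_units[OF q] q1 by (simp add: xe ye affine_group_simps)
  assume z: "z \<in> carrier (affine_group q)"
  obtain s'' t'' where ze: "z = (s'', t'')" by fastforce
  show "x \<otimes>\<^bsub>affine_group q\<^esub> y \<otimes>\<^bsub>affine_group q\<^esub> z = x \<otimes>\<^bsub>affine_group q\<^esub> (y \<otimes>\<^bsub>affine_group q\<^esub> z)"
  proof -
    have "[s'' * ((s' * t + t') mod q) + t'' = s'' * (s' * t + t') + t''] (mod q)"
      by (intro cong_add cong_mult cong_refl) (simp add: cong_def)
    moreover have "[s' * s'' mod q * t + (s'' * t' + t'') mod q = s' * s'' * t + (s'' * t' + t'')] (mod q)"
      by (intro cong_add cong_mult cong_refl) (simp_all add: cong_def)
    ultimately show ?thesis
      by (simp add: xe ye ze affine_group_simps cong_def mod_simps algebra_simps)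
  qed
qed

lemma affine_group_pow:
  assumes "1 < q"
  shows "(s, 0) [^]\<^bsub>affine_group q\<^esub> (n::nat) = (s ^ n mod q, 0)"
    and "(1, 1) [^]\<^bsub>affine_group q\<^esub> (n::nat) = (1, int n mod q)"
  using assms by (induction n) (simp_all add: affine_group_simps mod_simps algebra_simps)

section \<open>Powers and the commutation rule behind the normal form\<close>

context group
begin

lemma pow_mod_eq:
  assumes "x \<in> carrier G" "x [^] n = \<one>"
  shows "x [^] (m mod n :: nat) = x [^] m"
proof -
  have "x [^] m = x [^] (n * (m div n) + m mod n)" by simp
  also have "\<dots> = (x [^] n) [^] (m div n) \<otimes> x [^] (m mod n)"
    using assms(1) by (simp only: nat_pow_mult[symmetric] nat_pow_pow)
  finally show ?thesis using assms by simp
qed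

text \<open>The relator has an integer exponent \<open>r\<close>; reducing it modulo
  \<open>q\<close> permits natural exponents throughout the normal form.\<close>

lemma int_pow_eq_nat_pow_mod:
  assumes "x \<in> carrier G" "x [^] n = \<one>" "0 < n"
  shows "x [^] (r :: int) = x [^] nat (r mod int n)"
proof -
  have "x [^] r = x [^] (int n * (r div int n) + r mod int n)" by simp
  also have "\<dots> = (x [^] int n) [^] (r div int n) \<otimes> x [^] (r mod int n)"
    using assms(1) by (simp only: int_pow_mult int_pow_pow)
  also have "\<dots> = x [^] (r mod int n)" using assms by (simp add: int_pow_int)
  also have "\<dots> = x [^] nat (r mod int n)" using assms(3) by (simp add: int_pow_def2)
  finally show ?thesis .
qed

text \<open>Inverse generators thereby become positive powers, so closure under the generators
  themselves is enough.\<close>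

lemma inv_eq_pow:
  assumes "x \<in> carrier G" "x [^] (n::nat) = \<one>" "0 < n"
  shows "inv x = x [^] (n - 1)"
proof (rule inv_equality)
  have "x [^] Suc (n - 1) = \<one>" using assms by simp
  then show "x [^] (n - 1) \<otimes> x = \<one>" by simp
qed (use assms in auto)

text \<open>Each \<open>a\<close> that is moved to the left past a power of \<open>b\<close>
  multiplies the exponent of \<open>b\<close> by \<open>k\<close>.\<close>

lemma pow_commute_conj:
  assumes a: "a \<in> carrier G" and b: "b \<in> carrier G" and ba: "b \<otimes> a = a \<otimes> b [^] (k::nat)"
  shows "b [^] n \<otimes> a = a \<otimes> b [^] (k * n)" and "b \<otimes> a [^] n = a [^] n \<otimes> b [^] (k ^ n)"
proof -
  show *: "b [^] n \<otimes> a = a \<otimes> b [^] (k * n)" for n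
  proof (induction n)
    case (Suc n)
    have "b [^] Suc n \<otimes> a = b [^] n \<otimes> (b \<otimes> a)" using a b by (simp add: m_assoc)
    also have "\<dots> = (b [^] n \<otimes> a) \<otimes> b [^] k" using a b by (simp add: ba m_assoc)
    also have "\<dots> = a \<otimes> b [^] (k * n + k)" using a b by (simp add: Suc m_assoc nat_pow_mult)
    finally show ?case by (simp add: algebra_simps)
  qed (use a in simp)
  show "b \<otimes> a [^] n = a [^] n \<otimes> b [^] (k ^ n)"
  proof (induction n)
    case (Suc n)
    have "b \<otimes> a [^] Suc n = (b \<otimes> a [^] n) \<otimes> a" using a b by (simp add: m_assoc)
    also have "\<dots> = a [^] n \<otimes> (b [^] (k ^ n) \<otimes> a)" using a b by (simp add: Suc m_assoc)
    also have "\<dots> = a [^] Suc n \<otimes> b [^] (k ^ Suc n)" using a b by (simp add: * m_assoc)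
    finally show ?case .
  qed (use b in simp)
qed

end

definition F_pq_relators :: "nat \<Rightarrow> nat \<Rightarrow> int \<Rightarrow> gen word set set" where
  "F_pq_relators p q r = (let F = free_group; a = free_gen Gen_a; b = free_gen Gen_b in
     {a [^]\<^bsub>F\<^esub> p, b [^]\<^bsub>F\<^esub> q, inv\<^bsub>F\<^esub> a \<otimes>\<^bsub>F\<^esub> b \<otimes>\<^bsub>F\<^esub> a \<otimes>\<^bsub>F\<^esub> inv\<^bsub>F\<^esub> (b [^]\<^bsub>F\<^esub> r)})"

lemma F_pq_eq: "F_pq p q r = presented_group (F_pq_relators p q r)"
  by (simp add: F_pq_def F_pq_relators_def Let_def)

lemma F_pq_relators_closed: "F_pq_relators p q r \<subseteq> carrier free_group"
  by (auto simp: F_pq_relators_def Let_def)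

lemma group_F_pq: "group (F_pq p q r)"
  unfolding F_pq_eq by (rule group_presented_group[OF F_pq_relators_closed])

text \<open>Used in both directions: in the affine group the relations are verified in order to
  construct \<open>\<phi>\<close>, and in \<open>F_pq\<close> they are extracted from the quotient
  map.\<close>

lemma relators_trivial_iff:
  assumes "h \<in> hom free_group H" "group H"
  defines "a \<equiv> h (free_gen Gen_a)" and "b \<equiv> h (free_gen Gen_b)"
  shows "(\<forall>w\<in>F_pq_relators p q r. h w = \<one>\<^bsub>H\<^esub>) \<longleftrightarrow>
    a [^]\<^bsub>H\<^esub> p = \<one>\<^bsub>H\<^esub> \<and> b [^]\<^bsub>H\<^esub> q = \<one>\<^bsub>H\<^esub> \<and> b \<otimes>\<^bsub>H\<^esub> a = a \<otimes>\<^bsub>H\<^esub> b [^]\<^bsub>H\<^esub> r"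
proof -
  interpret h: group_hom free_group H h
    using assms(1,2) group_free_group by (simp add: group_hom_def group_hom_axioms_def)
  have c: "a \<in> carrier H" "b \<in> carrier H" by (simp_all add: a_def b_def)
  have "u \<otimes>\<^bsub>H\<^esub> inv\<^bsub>H\<^esub> v = \<one>\<^bsub>H\<^esub> \<longleftrightarrow> u = v" if "u \<in> carrier H" "v \<in> carrier H" for u v
    using that h.H.inv_equality[of u "inv\<^bsub>H\<^esub> v"] by auto
  then have "inv\<^bsub>H\<^esub> a \<otimes>\<^bsub>H\<^esub> b \<otimes>\<^bsub>H\<^esub> a \<otimes>\<^bsub>H\<^esub> inv\<^bsub>H\<^esub> (b [^]\<^bsub>H\<^esub> r) = \<one>\<^bsub>H\<^esub> \<longleftrightarrow>
      inv\<^bsub>H\<^esub> a \<otimes>\<^bsub>H\<^esub> (b \<otimes>\<^bsub>H\<^esub> a) = b [^]\<^bsub>H\<^esub> r"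
    using c by (simp add: h.H.m_assoc[of "inv\<^bsub>H\<^esub> a" b a])
  also have "\<dots> \<longleftrightarrow> b \<otimes>\<^bsub>H\<^esub> a = a \<otimes>\<^bsub>H\<^esub> b [^]\<^bsub>H\<^esub> r"
    using c by (subst eq_commute, subst h.H.inv_solve_left) auto
  finally show ?thesis
    by (simp add: F_pq_relators_def Let_def h.hom_nat_pow h.hom_int_pow flip: a_def b_def)
qed

section \<open>Faithful representation of \<open>F_pq\<close> by affine maps\<close>

lemma F_pq_embedding:
  assumes p: "prime p" and q: "prime q"
    and r: "[r ^ p = 1] (mod int q)" "\<not> [r = 1] (mod int q)"
  obtains \<phi> S where "\<phi> \<in> hom (F_pq p q r) (affine_group (int q))"
    "inj_on \<phi> (carrier (F_pq p q r))"
    "\<phi> ` carrier (F_pq p q r) = S \<times> {0..<int q}" "card S = p" "1 \<in> S"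
proof -
  define \<rho> where "\<rho> = r mod int q"
  let ?A = "affine_group (int q)" and ?F = "F_pq p q r" and ?R = "F_pq_relators p q r"
  let ?\<alpha> = "(\<rho>, 0) :: int \<times> int" and ?\<beta> = "(1, 1) :: int \<times> int"
  have q': "prime (int q)" "1 < int q" using q prime_gt_1_nat by auto
  interpret A: group ?A by (rule group_affine_group[OF q'(1)])
  interpret F: group ?F by (rule group_F_pq)
  have \<rho>_pow: "\<rho> ^ n mod int q = r ^ n mod int q" for n by (simp add: \<rho>_def mod_simps)
  have "\<not> int q dvd r"
  proof
    assume "int q dvd r"
    then have "[r ^ p = 0] (mod int q)"
      using p by (simp add: cong_0_iff dvd_power_le prime_gt_0_nat dvd_trans[OF _ dvd_power])
    then have "[1 = 0] (mod int q)" using r(1) cong_sym cong_trans by blast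
    then show False using q' by (simp add: cong_0_iff)
  qed
  then have \<alpha>: "?\<alpha> \<in> carrier ?A"
    using mod_in_units[OF q'(1)] q' by (simp add: affine_group_simps \<rho>_def)
  have \<beta>: "?\<beta> \<in> carrier ?A" using q' by (simp add: affine_group_simps)
  have \<alpha>_pow: "?\<alpha> [^]\<^bsub>?A\<^esub> n = (r ^ n mod int q, 0)" for n :: nat
    by (simp add: affine_group_pow[OF q'(2)] \<rho>_pow)
  have \<beta>_pow: "?\<beta> [^]\<^bsub>?A\<^esub> n = (1, int n mod int q)" for n :: nat
    by (simp add: affine_group_pow[OF q'(2)])
  have \<alpha>p: "?\<alpha> [^]\<^bsub>?A\<^esub> p = \<one>\<^bsub>?A\<^esub>" using r(1) q' by (simp add: \<alpha>_pow cong_def affine_group_simps)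
  have \<beta>q: "?\<beta> [^]\<^bsub>?A\<^esub> q = \<one>\<^bsub>?A\<^esub>" by (simp add: \<beta>_pow affine_group_simps)
  \<comment> \<open>The order divides the prime \<open>p\<close> and is not 1 because
    \<open>r\<close> is not 1 modulo \<open>q\<close>. The exact order is what later separates the
    powers of \<open>a\<close>.\<close>
  have "A.ord ?\<alpha> dvd p" using \<alpha>p A.pow_eq_id[OF \<alpha>] by simp
  moreover have "A.ord ?\<alpha> \<noteq> 1"
    using A.pow_eq_id[OF \<alpha>, of 1] \<alpha>_pow[of 1] r(2) q' by (auto simp: affine_group_simps cong_def)
  ultimately have ord_\<alpha>: "A.ord ?\<alpha> = p" using p by (auto simp: prime_nat_iff)

  obtain h where h: "h \<in> hom free_group ?A"
    "\<And>x. h (free_gen x) = (case x of Gen_a \<Rightarrow> ?\<alpha> | Gen_b \<Rightarrow> ?\<beta>)"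
    by (rule A.free_group_hom[of "case_gen ?\<alpha> ?\<beta>"]) (use \<alpha> \<beta> in \<open>auto split: gen.split\<close>)
  have "?\<beta> [^]\<^bsub>?A\<^esub> r = (1, r mod int q)"
    using q' by (simp add: A.int_pow_eq_nat_pow_mod[OF \<beta> \<beta>q] \<beta>_pow)
  then have "?\<beta> \<otimes>\<^bsub>?A\<^esub> ?\<alpha> = ?\<alpha> \<otimes>\<^bsub>?A\<^esub> ?\<beta> [^]\<^bsub>?A\<^esub> r"
    by (simp add: affine_group_simps \<rho>_def)
  then have *: "\<forall>w\<in>?R. h w = \<one>\<^bsub>?A\<^esub>"
    by (subst relators_trivial_iff[OF h(1) A.group_axioms]) (simp add: h(2) \<alpha>p \<beta>q)
  obtain \<phi> where \<phi>: "\<phi> \<in> hom (presented_group ?R) ?A" "\<And>x. \<phi> (presented_gen ?R x) = h (free_gen x)"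
    by (rule presented_group_hom[OF F_pq_relators_closed h(1) A.group_axioms])
      (use * in blast, rule that)
  note \<phi> = \<phi>[folded F_pq_eq]
  interpret \<phi>: group_hom ?F ?A \<phi> using \<phi>(1) by unfold_locales
  define a where "a = presented_gen ?R Gen_a"
  define b where "b = presented_gen ?R Gen_b"
  have a: "a \<in> carrier ?F" and b: "b \<in> carrier ?F"
    unfolding a_def b_def F_pq_eq by (rule presented_gen_closed[OF F_pq_relators_closed])+
  have \<phi>ab: "\<phi> a = ?\<alpha>" "\<phi> b = ?\<beta>" by (simp_all add: a_def b_def \<phi>(2) h(2))

  obtain \<pi> where \<pi>: "\<pi> \<in> hom free_group (presented_group ?R)"
    "\<And>w. w \<in> ?R \<Longrightarrow> \<pi> w = \<one>\<^bsub>presented_group ?R\<^esub>"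
    "\<And>x. \<pi> (free_gen x) = presented_gen ?R x"
    by (rule presentation_hom[OF F_pq_relators_closed[of p q r]]) (rule that)
  note \<pi> = \<pi>[folded F_pq_eq]
  have rel: "a [^]\<^bsub>?F\<^esub> p = \<one>\<^bsub>?F\<^esub>" "b [^]\<^bsub>?F\<^esub> q = \<one>\<^bsub>?F\<^esub>" "b \<otimes>\<^bsub>?F\<^esub> a = a \<otimes>\<^bsub>?F\<^esub> b [^]\<^bsub>?F\<^esub> r"
    using relators_trivial_iff[OF \<pi>(1) F.group_axioms, of p q r] \<pi>(2)
    by (simp_all add: \<pi>(3) a_def b_def)
  define k where "k = nat (r mod int q)"
  have ba: "b \<otimes>\<^bsub>?F\<^esub> a = a \<otimes>\<^bsub>?F\<^esub> b [^]\<^bsub>?F\<^esub> k"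
    using rel(3) unfolding k_def F.int_pow_eq_nat_pow_mod[OF b rel(2) prime_gt_0_nat[OF q]] .

  \<comment> \<open>The normal forms. Left multiplication by \<open>a\<close> raises the first
    exponent; left multiplication by \<open>b\<close> passes through \<open>a^i\<close> and only
    changes the second. So \<open>H\<close> is the whole group.\<close>
  define H where "H = {a [^]\<^bsub>?F\<^esub> i \<otimes>\<^bsub>?F\<^esub> b [^]\<^bsub>?F\<^esub> j | (i::nat) (j::nat). True}"
  have Ha: "a \<otimes>\<^bsub>?F\<^esub> x \<in> H" if x: "x \<in> H" for x
  proof -
    obtain i j :: nat where "x = a [^]\<^bsub>?F\<^esub> i \<otimes>\<^bsub>?F\<^esub> b [^]\<^bsub>?F\<^esub> j" using x by (auto simp: H_def)
    then have "a \<otimes>\<^bsub>?F\<^esub> x = a [^]\<^bsub>?F\<^esub> Suc i \<otimes>\<^bsub>?F\<^esub> b [^]\<^bsub>?F\<^esub> j"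
      unfolding F.nat_pow_Suc2[OF a] using a b by (simp add: F.m_assoc)
    then show ?thesis unfolding H_def by blast
  qed
  have Hb: "b \<otimes>\<^bsub>?F\<^esub> x \<in> H" if x: "x \<in> H" for x
  proof -
    obtain i j :: nat where "x = a [^]\<^bsub>?F\<^esub> i \<otimes>\<^bsub>?F\<^esub> b [^]\<^bsub>?F\<^esub> j" using x by (auto simp: H_def)
    then have "b \<otimes>\<^bsub>?F\<^esub> x = (b \<otimes>\<^bsub>?F\<^esub> a [^]\<^bsub>?F\<^esub> i) \<otimes>\<^bsub>?F\<^esub> b [^]\<^bsub>?F\<^esub> j"
      using a b by (simp add: F.m_assoc)
    also have "\<dots> = a [^]\<^bsub>?F\<^esub> i \<otimes>\<^bsub>?F\<^esub> b [^]\<^bsub>?F\<^esub> (k ^ i + j)"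
      using a b by (simp add: F.pow_commute_conj(2)[OF a b ba] F.m_assoc F.nat_pow_mult)
    finally show ?thesis unfolding H_def by blast
  qed
  have H_sub: "H \<subseteq> carrier ?F" using a b by (auto simp: H_def)
  have H_pow: "c [^]\<^bsub>?F\<^esub> n \<otimes>\<^bsub>?F\<^esub> x \<in> H" if "x \<in> H" "c = a \<or> c = b" for c x and n :: nat
  proof (induction n)
    case (Suc n)
    have c: "c \<in> carrier ?F" "x \<in> carrier ?F" using that a b H_sub by auto
    then have "c [^]\<^bsub>?F\<^esub> Suc n \<otimes>\<^bsub>?F\<^esub> x = c \<otimes>\<^bsub>?F\<^esub> (c [^]\<^bsub>?F\<^esub> n \<otimes>\<^bsub>?F\<^esub> x)"
      unfolding F.nat_pow_Suc2[OF c(1)] by (simp add: F.m_assoc)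
    with Suc that Ha Hb show ?case by auto
  qed (use that H_sub in auto)
  have "y \<in> H" if "y \<in> carrier ?F" for y
    using that unfolding F_pq_eq
  proof (induction rule: presented_group_induct[OF F_pq_relators_closed, consumes 1, case_names one gen inv])
    case one
    have "\<one>\<^bsub>?F\<^esub> = a [^]\<^bsub>?F\<^esub> (0::nat) \<otimes>\<^bsub>?F\<^esub> b [^]\<^bsub>?F\<^esub> (0::nat)" by simp
    then show ?case unfolding H_def F_pq_eq by blast
  next
    case (gen x y)
    then show ?case using Ha Hb by (cases x) (simp_all add: a_def b_def F_pq_eq)
  next
    case (inv x y)
    then show ?case
      using H_pow[of y a "p - 1"] H_pow[of y b "q - 1"] F.inv_eq_pow[OF a rel(1)] F.inv_eq_pow[OF b rel(2)]
        prime_gt_0_nat[OF p] prime_gt_0_nat[OF q]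
      by (cases x) (simp_all add: a_def b_def F_pq_eq)
  qed
  with H_sub have H: "carrier ?F = H" by blast
  have \<phi>H: "\<phi> (a [^]\<^bsub>?F\<^esub> i \<otimes>\<^bsub>?F\<^esub> b [^]\<^bsub>?F\<^esub> j) = (r ^ i mod int q, int j mod int q)" for i j :: nat
    using a b by (simp add: \<phi>.hom_nat_pow \<phi>ab \<alpha>_pow \<beta>_pow affine_group_simps mod_simps)
  \<comment> \<open>The linear parts that occur are the powers of \<open>r\<close> modulo
    \<open>q\<close>. The range \<open>{0..p - 1}\<close> is the one on which \<open>ord_inj\<close>
    makes them distinct.\<close>
  define S where "S = (\<lambda>i. r ^ i mod int q) ` {0..p - 1}"
  show ?thesis
  proof (rule that[of \<phi> S])
    show "inj_on \<phi> (carrier ?F)"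
    proof (subst \<phi>.inj_on_one_iff, intro allI impI)
      fix x assume "x \<in> carrier ?F" and x1: "\<phi> x = \<one>\<^bsub>?A\<^esub>"
      then obtain i j :: nat where x: "x = a [^]\<^bsub>?F\<^esub> i \<otimes>\<^bsub>?F\<^esub> b [^]\<^bsub>?F\<^esub> j"
        unfolding H H_def by blast
      then have *: "r ^ i mod int q = 1" "int j mod int q = 0"
        using x1 \<phi>H by (simp_all add: affine_group_simps)
      then have "?\<alpha> [^]\<^bsub>?A\<^esub> i = \<one>\<^bsub>?A\<^esub>" by (simp add: \<alpha>_pow affine_group_simps)
      \<comment> \<open>A normal form in the kernel has exponents divisible by \<open>p\<close> and
        \<open>q\<close>, and the relations \<open>a^p = b^q = 1\<close> in \<open>F_pq\<close> then
        make it trivial.\<close>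
      then have "i mod p = 0" using A.pow_eq_id[OF \<alpha>] by (simp add: ord_\<alpha>)
      moreover have "j mod q = 0" using *(2) by (simp flip: zmod_int)
      ultimately show "x = \<one>\<^bsub>?F\<^esub>"
        unfolding x F.pow_mod_eq[OF a rel(1), of i, symmetric] F.pow_mod_eq[OF b rel(2), of j, symmetric]
        by simp
    qed
    show "\<phi> ` carrier ?F = S \<times> {0..<int q}"
    proof (intro equalityI subsetI)
      fix z assume "z \<in> \<phi> ` carrier ?F"
      then obtain i j :: nat where x: "z = \<phi> (a [^]\<^bsub>?F\<^esub> i \<otimes>\<^bsub>?F\<^esub> b [^]\<^bsub>?F\<^esub> j)"
        unfolding H H_def by blast
      have "r ^ i mod int q = r ^ (i mod p) mod int q"
        using A.pow_mod_eq[OF \<alpha> \<alpha>p, of i] by (simp add: \<alpha>_pow)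
      moreover have "i mod p \<in> {0..p - 1}"
        using prime_gt_0_nat[OF p] by (simp add: less_Suc_eq_le[symmetric])
      ultimately show "z \<in> S \<times> {0..<int q}"
        using q' by (auto simp: x \<phi>H S_def)
    next
      fix z assume "z \<in> S \<times> {0..<int q}"
      then obtain i t where z: "z = (r ^ i mod int q, t)" "0 \<le> t" "t < int q" by (auto simp: S_def)
      then obtain j where "t = int j" by (metis nonneg_int_cases)
      with z have "z = \<phi> (a [^]\<^bsub>?F\<^esub> i \<otimes>\<^bsub>?F\<^esub> b [^]\<^bsub>?F\<^esub> j)" by (simp add: \<phi>H)
      then show "z \<in> \<phi> ` carrier ?F" unfolding H H_def by blast
    qed
    have "inj_on (\<lambda>i. r ^ i mod int q) {0..p - 1}"
      using A.ord_inj[OF \<alpha>] by (simp add: \<alpha>_pow ord_\<alpha> inj_on_def)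
    then show "card S = p" using prime_gt_0_nat[OF p] by (simp add: S_def card_image)
    show "1 \<in> S" unfolding S_def using q'(2) by (intro image_eqI[of _ _ 0]) simp_all
  qed (rule \<phi>(1))
qed

section \<open>Engel graphs of subgroups of the affine group\<close>

text \<open>Only an embedding and the shape of its image are recorded, so an arbitrary copy of
  \<open>F_pq\<close> fits in after composing with the isomorphism.\<close>

locale affine_subgroup = group G for G (structure) +
  fixes \<phi> :: "'a \<Rightarrow> int \<times> int" and q :: nat and S :: "int set"
  assumes q: "prime q"
    and hom: "\<phi> \<in> hom G (affine_group (int q))"
    and inj: "inj_on \<phi> (carrier G)"
    and img: "\<phi> ` carrier G = S \<times> {0..<int q}"
    and one_in_S: "1 \<in> S"
begin

text \<open>The element acts as \<open>z \<mapsto> \<sigma> z + \<tau>\<close>; its two coefficients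
  carry all later computations.\<close>

definition \<sigma> :: "'a \<Rightarrow> int" where "\<sigma> x = fst (\<phi> x)"

definition \<tau> :: "'a \<Rightarrow> int" where "\<tau> x = snd (\<phi> x)"

definition shifts :: "'a set" where "shifts = {x \<in> carrier G. \<sigma> x = 1}"

lemma q_int: "prime (int q)" "1 < int q"
  using q prime_gt_1_nat by auto

lemma \<phi>_eq: "\<phi> x = (\<sigma> x, \<tau> x)"
  by (simp add: \<sigma>_def \<tau>_def)

lemma ranges:
  assumes "x \<in> carrier G"
  shows "1 \<le> \<sigma> x" "\<sigma> x < int q" "0 \<le> \<tau> x" "\<tau> x < int q"
  using hom assms by (auto simp: hom_def Pi_def affine_group_simps \<phi>_eq)

lemma \<sigma>_not_dvd: "x \<in> carrier G \<Longrightarrow> \<not> int q dvd \<sigma> x"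
  using ranges[of x] unit_not_dvd[of "\<sigma> x"] by simp

lemma \<phi>_mult:
  assumes "x \<in> carrier G" "y \<in> carrier G"
  shows "\<sigma> (x \<otimes> y) = \<sigma> x * \<sigma> y mod int q" "\<tau> (x \<otimes> y) = (\<sigma> y * \<tau> x + \<tau> y) mod int q"
proof -
  have "\<phi> (x \<otimes> y) = \<phi> x \<otimes>\<^bsub>affine_group (int q)\<^esub> \<phi> y" using hom_mult[OF hom assms] .
  then show "\<sigma> (x \<otimes> y) = \<sigma> x * \<sigma> y mod int q" "\<tau> (x \<otimes> y) = (\<sigma> y * \<tau> x + \<tau> y) mod int q"
    by (simp_all add: \<phi>_eq affine_group_simps)
qed

lemma \<phi>_one: "\<sigma> \<one> = 1" "\<tau> \<one> = 0"
  using hom_one[OF hom is_group group_affine_group[OF q_int(1)]] by (simp_all add: \<phi>_eq affine_group_simps)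

lemma eq_oneI: "x \<in> shifts \<Longrightarrow> int q dvd \<tau> x \<Longrightarrow> x = \<one>"
  using ranges[of x] inj \<phi>_one
  by (auto simp: shifts_def \<phi>_eq inj_on_def dvd_eq_mod_eq_0)

section \<open>Commutators in coordinates and adjacency\<close>

lemma commutator_closed: "x \<in> carrier G \<Longrightarrow> y \<in> carrier G \<Longrightarrow> commutator G x y \<in> carrier G"
  by (simp add: commutator_def)

text \<open>Inverses are avoided by comparing coordinates in \<open>y x [x, y] = x y\<close>. The
  linear parts of \<open>x y\<close> and \<open>y x\<close> agree and are units, so that of the
  commutator is 1; then its translation part is the difference of those of \<open>x y\<close> and
  \<open>y x\<close>.\<close>

lemma \<phi>_commutator:
  assumes x: "x \<in> carrier G" and y: "y \<in> carrier G"
  shows "commutator G x y \<in> shifts"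
    and "[\<tau> (commutator G x y) = \<tau> y * (1 - \<sigma> x) - \<tau> x * (1 - \<sigma> y)] (mod int q)"
proof -
  let ?c = "commutator G x y"
  have c: "?c \<in> carrier G" using assms by (rule commutator_closed)
  have "y \<otimes> x \<otimes> ?c = y \<otimes> (x \<otimes> inv x) \<otimes> inv y \<otimes> (x \<otimes> y)"
    using x y by (simp only: commutator_def m_assoc m_closed inv_closed)
  then have eq: "y \<otimes> x \<otimes> ?c = x \<otimes> y" using x y by simp
  have "[\<sigma> (y \<otimes> x) * \<sigma> ?c = \<sigma> (y \<otimes> x) * 1] (mod int q)"
    using arg_cong[OF eq, of \<sigma>] x y c by (simp add: \<phi>_mult cong_def mult.commute)
  moreover have "coprime (\<sigma> (y \<otimes> x)) (int q)"
    using prime_imp_coprime[OF q_int(1) \<sigma>_not_dvd, of "y \<otimes> x"] x y by (simp add: coprime_commute)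
  ultimately have "[\<sigma> ?c = 1] (mod int q)" using cong_mult_lcancel by blast
  then have \<sigma>1: "\<sigma> ?c = 1" using ranges[OF c] q_int by (simp add: cong_def)
  then show "?c \<in> shifts" using c by (simp add: shifts_def)
  have "[\<tau> (y \<otimes> x) + \<tau> ?c = \<tau> (x \<otimes> y)] (mod int q)"
    using arg_cong[OF eq, of \<tau>] \<phi>_mult(2)[of "y \<otimes> x" ?c] ranges[of "x \<otimes> y"] x y c \<sigma>1 by (simp add: cong_def)
  then have "[\<tau> (y \<otimes> x) + \<tau> ?c - \<tau> (y \<otimes> x) = \<tau> (x \<otimes> y) - \<tau> (y \<otimes> x)] (mod int q)"
    by (rule cong_diff) simp
  also have "[\<tau> (x \<otimes> y) - \<tau> (y \<otimes> x) = (\<sigma> y * \<tau> x + \<tau> y) - (\<sigma> x * \<tau> y + \<tau> x)] (mod int q)"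
    using x y by (intro cong_diff) (simp_all add: \<phi>_mult cong_def)
  finally show "[\<tau> ?c = \<tau> y * (1 - \<sigma> x) - \<tau> x * (1 - \<sigma> y)] (mod int q)"
    by (simp add: algebra_simps)
qed

lemma commutator_eq_one_iff:
  assumes "x \<in> carrier G" "y \<in> carrier G"
  shows "commutator G x y = \<one> \<longleftrightarrow> int q dvd \<tau> y * (1 - \<sigma> x) - \<tau> x * (1 - \<sigma> y)"
  using \<phi>_commutator[OF assms] eq_oneI[OF \<phi>_commutator(1)[OF assms]] \<phi>_one
  by (metis cong_dvd_iff dvd_0_right)

lemma not_dvd_one_minus_\<sigma>:
  assumes "y \<in> carrier G - shifts"
  shows "\<not> int q dvd 1 - \<sigma> y"
proof -
  have "1 < \<sigma> y" "\<sigma> y < int q" using assms ranges[of y] by (auto simp: shifts_def)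
  then show ?thesis using zdvd_not_zless[of "\<sigma> y - 1" "int q"] by (simp add: dvd_diff_commute)
qed

text \<open>With \<open>\<sigma> c = 1\<close> the formula leaves, up to sign,
  \<open>\<tau> c * (1 - \<sigma> y)\<close>, a product of two nonzero residues modulo a prime. Both
  the Engel condition and the Fitting subgroup rest on this.\<close>

lemma commutator_translation:
  assumes c: "c \<in> shifts - {\<one>}" and y: "y \<in> carrier G - shifts"
  shows "commutator G c y \<in> shifts - {\<one>}"
proof -
  have carr: "c \<in> carrier G" "y \<in> carrier G" "\<sigma> c = 1" using c y by (auto simp: shifts_def)
  have "\<not> int q dvd \<tau> c" using c eq_oneI by auto
  then have "\<not> int q dvd \<tau> c * (1 - \<sigma> y)"
    using not_dvd_one_minus_\<sigma>[OF y] q_int by (simp add: prime_dvd_mult_iff)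
  then have "commutator G c y \<noteq> \<one>"
    using carr by (simp add: commutator_eq_one_iff)
  with \<phi>_commutator(1)[OF carr(1,2)] show ?thesis by simp
qed

text \<open>The first commutator is already a nontrivial shift, and further ones stay so. The
  induction is on \<open>Suc n\<close> since \<open>[x, \<^sub>0 y] = x\<close> need not be a
  shift.\<close>

lemma iter_commutator_neq_one:
  assumes x: "x \<in> carrier G" and y: "y \<in> carrier G - shifts"
    and ne: "commutator G x y \<noteq> \<one>" and k: "1 \<le> k"
  shows "iter_commutator G x k y \<noteq> \<one>"
proof -
  have "iter_commutator G x (Suc n) y \<in> shifts - {\<one>}" for n
  proof (induction n)
    case 0
    show ?case using \<phi>_commutator(1)[of x y] x y ne by simp
  next
    case (Suc n)
    then show ?case using commutator_translation[OF _ y] by simp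
  qed
  from this[of "k - 1"] k show ?thesis by simp
qed

text \<open>The case \<open>k = 1\<close> gives one direction. For the other, exchanging
  \<open>x\<close> and \<open>y\<close> only changes the sign of the expression, so both commutators
  are nontrivial together.\<close>

lemma engel_adjacent_iff:
  assumes x: "x \<in> carrier G - shifts" and y: "y \<in> carrier G - shifts"
  shows "(\<forall>k\<ge>1. iter_commutator G x k y \<noteq> \<one> \<and> iter_commutator G y k x \<noteq> \<one>) \<longleftrightarrow>
    \<not> int q dvd \<tau> y * (1 - \<sigma> x) - \<tau> x * (1 - \<sigma> y)" (is "?E \<longleftrightarrow> ?D")
proof
  assume ?E
  then have "iter_commutator G x 1 y \<noteq> \<one>" by blast
  then show ?D using x y by (simp add: commutator_eq_one_iff)
next
  assume D: ?D
  then have "\<not> int q dvd \<tau> x * (1 - \<sigma> y) - \<tau> y * (1 - \<sigma> x)" by (simp add: dvd_diff_commute)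
  with D have "commutator G x y \<noteq> \<one>" "commutator G y x \<noteq> \<one>"
    using x y by (simp_all add: commutator_eq_one_iff)
  then show ?E using iter_commutator_neq_one x y by blast
qed

section \<open>The Fitting subgroup\<close>

lemma shifts_normal: "shifts \<lhd> G"
proof -
  have inv: "\<sigma> (inv x) = 1" if "x \<in> shifts" for x
  proof -
    have x: "x \<in> carrier G" "\<sigma> x = 1" using that by (auto simp: shifts_def)
    then show ?thesis using \<phi>_mult(1)[of "inv x" x] \<phi>_one ranges[of "inv x"] by simp
  qed
  have "subgroup shifts G"
    by (rule subgroupI)
      (use \<phi>_one inv q_int in \<open>auto simp: shifts_def \<phi>_mult\<close>)
  moreover have "x \<otimes> h \<otimes> inv x \<in> shifts" if "x \<in> carrier G" "h \<in> shifts" for x h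
  proof -
    have h: "h \<in> carrier G" "\<sigma> h = 1" using that by (auto simp: shifts_def)
    have "\<sigma> (x \<otimes> h) = \<sigma> x" using that(1) h ranges[of x] by (simp add: \<phi>_mult)
    then have "\<sigma> (x \<otimes> h \<otimes> inv x) = \<sigma> (x \<otimes> inv x)" using that(1) h by (simp only: \<phi>_mult m_closed inv_closed)
    then show ?thesis using that(1) h \<phi>_one by (simp add: shifts_def)
  qed
  ultimately show ?thesis by (simp add: normal_inv_iff)
qed

lemma commutator_consistent:
  assumes "subgroup N G" "x \<in> N" "y \<in> N"
  shows "commutator (G\<lparr>carrier := N\<rparr>) x y = commutator G x y"
  using assms by (simp add: commutator_def m_inv_consistent)

text \<open>Two shifts commute because both factors \<open>1 - \<sigma>\<close> vanish, so the lower
  central series ends after one step.\<close>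

lemma shifts_nilpotent: "nilpotent_group (G\<lparr>carrier := shifts\<rparr>)"
proof -
  let ?T = "G\<lparr>carrier := shifts\<rparr>"
  have sub: "subgroup shifts G" using shifts_normal by (rule normal_imp_subgroup)
  then interpret T: group ?T by (rule subgroup_imp_group)
  have "commutator ?T x y = \<one>" if "x \<in> shifts" "y \<in> shifts" for x y
    using that by (subst commutator_consistent[OF sub that], subst commutator_eq_one_iff)
      (auto simp: shifts_def)
  then have "{commutator ?T x y | x y. x \<in> lower_central ?T 0 \<and> y \<in> carrier ?T} \<subseteq> {\<one>\<^bsub>?T\<^esub>}"
    by auto
  from T.generate_subgroup_incl[OF this T.triv_subgroup]
  have "lower_central ?T 1 \<subseteq> {\<one>\<^bsub>?T\<^esub>}" by (simp only: One_nat_def lower_central.simps)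
  moreover have "\<one>\<^bsub>?T\<^esub> \<in> lower_central ?T 1"
    unfolding One_nat_def lower_central.simps by (rule generate.one)
  ultimately have "lower_central ?T 1 = {\<one>\<^bsub>?T\<^esub>}" by blast
  then show ?thesis unfolding nilpotent_group_def using T.is_group by blast
qed

text \<open>If \<open>N\<close> contained some \<open>x\<close> that is not a shift, then all the iterated commutators
  \<open>[c, x, \<dots>, x]\<close> with a shift \<open>c \<noteq> 1\<close> would be nontrivial elements of its lower central series.\<close>

lemma nilpotent_normal_subset:
  assumes N: "N \<lhd> G" and nil: "nilpotent_group (G\<lparr>carrier := N\<rparr>)"
  shows "N \<subseteq> shifts"
proof (rule ccontr)
  assume "\<not> N \<subseteq> shifts"
  then obtain x where xN: "x \<in> N" and "x \<notin> shifts" by blast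
  have sub: "subgroup N G" using N by (rule normal_imp_subgroup)
  have x: "x \<in> carrier G - shifts"
    using subgroup.mem_carrier[OF sub xN] \<open>x \<notin> shifts\<close> by simp
  have "(1, 1) \<in> \<phi> ` carrier G" using img one_in_S q_int by simp
  then obtain b where b: "b \<in> carrier G" "\<phi> b = (1, 1)" by (metis imageE)
  have "b \<in> shifts - {\<one>}" using b \<phi>_one by (auto simp: shifts_def \<sigma>_def \<tau>_def)
  then have c0: "commutator G b x \<in> shifts - {\<one>}" using x by (rule commutator_translation)
  \<comment> \<open>The shift \<open>b\<close> need not lie in \<open>N\<close>, but
    \<open>[b, x]\<close> is a conjugate of the inverse of \<open>x\<close> times \<open>x\<close>
    and does. It is therefore the starting element.\<close>
  have "inv b \<otimes> inv x \<otimes> b \<in> N"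
    using normal.inv_op_closed1[OF N b(1)] subgroup.m_inv_closed[OF sub xN] by blast
  then have c0N: "commutator G b x \<in> N"
    unfolding commutator_def using xN subgroup.m_closed[OF sub] by blast
  let ?N = "G\<lparr>carrier := N\<rparr>"
  interpret N: group ?N using sub by (rule subgroup_imp_group)
  \<comment> \<open>Membership in \<open>N\<close> is carried along so that commutators formed in
    the restricted group agree with those of \<open>G\<close>.\<close>
  have "\<exists>c. c \<in> lower_central ?N n \<and> c \<in> N \<and> c \<in> shifts - {\<one>}" for n
  proof (induction n)
    case 0
    show ?case using c0 c0N by auto
  next
    case (Suc n)
    then obtain c where c: "c \<in> lower_central ?N n" "c \<in> N" "c \<in> shifts - {\<one>}" by blast
    have "commutator ?N c x \<in> lower_central ?N (Suc n)"
      using c xN by (auto intro!: generate.incl)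
    moreover have "commutator ?N c x \<in> N"
      unfolding commutator_consistent[OF sub c(2) xN] commutator_def
      using sub c(2) xN by (auto intro!: subgroup.m_closed subgroup.m_inv_closed)
    moreover have "commutator ?N c x \<in> shifts - {\<one>}"
      unfolding commutator_consistent[OF sub c(2) xN] using c(3) x by (rule commutator_translation)
    ultimately show ?case by blast
  qed
  then have "lower_central ?N n \<noteq> {\<one>}" for n by blast
  then show False using nil by (simp add: nilpotent_group_def)
qed

lemma fitting_subgroup_eq: "fitting_subgroup G = shifts"
proof -
  have "\<Union> {N. N \<lhd> G \<and> nilpotent_group (G\<lparr>carrier := N\<rparr>)} = shifts"
    using shifts_normal shifts_nilpotent nilpotent_normal_subset by blast
  then show ?thesis unfolding fitting_subgroup_def
    using generateI[OF normal_imp_subgroup[OF shifts_normal], of shifts] by simp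
qed

text \<open>The condition is \<open>\<sigma> u + \<tau> = u\<close> rearranged. Choosing the natural
  number below \<open>q\<close> makes the fixed point usable as the index of a part.\<close>

definition fixpoint :: "'a \<Rightarrow> nat" where
  "fixpoint x = (SOME u. u < q \<and> [\<tau> x = (1 - \<sigma> x) * int u] (mod int q))"

lemma fixpoint_eq_iff:
  assumes x: "x \<in> carrier G - shifts"
  shows "fixpoint x < q" "[\<tau> x = (1 - \<sigma> x) * int (fixpoint x)] (mod int q)"
    and "u < q \<Longrightarrow> fixpoint x = u \<longleftrightarrow> [\<tau> x = (1 - \<sigma> x) * int u] (mod int q)"
proof -
  have cop: "coprime (1 - \<sigma> x) (int q)"
    using prime_imp_coprime[OF q_int(1) not_dvd_one_minus_\<sigma>[OF x]] by (simp add: coprime_commute)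
  then obtain v where v: "[(1 - \<sigma> x) * v = 1] (mod int q)" using cong_solve_coprime_int by blast
  \<comment> \<open>Since \<open>v\<close> inverts \<open>1 - \<sigma> x\<close>, the fixed point is
    \<open>\<tau> x / (1 - \<sigma> x)\<close>.\<close>
  define w where "w = nat (v * \<tau> x mod int q)"
  have w: "int w = v * \<tau> x mod int q" using q_int by (simp add: w_def)
  have "[(1 - \<sigma> x) * int w = (1 - \<sigma> x) * (v * \<tau> x)] (mod int q)"
    by (intro cong_mult cong_refl) (simp add: w cong_def)
  also have "[(1 - \<sigma> x) * (v * \<tau> x) = 1 * \<tau> x] (mod int q)"
    unfolding mult.assoc[symmetric] using v by (intro cong_mult cong_refl)
  finally have "[\<tau> x = (1 - \<sigma> x) * int w] (mod int q)" by (simp add: cong_sym)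
  moreover have "int w < int q" using q_int by (simp add: w)
  then have "w < q" by simp
  ultimately have "\<exists>u. u < q \<and> [\<tau> x = (1 - \<sigma> x) * int u] (mod int q)" by blast
  then have fp: "fixpoint x < q \<and> [\<tau> x = (1 - \<sigma> x) * int (fixpoint x)] (mod int q)"
    unfolding fixpoint_def by (rule someI_ex)
  then show "fixpoint x < q" "[\<tau> x = (1 - \<sigma> x) * int (fixpoint x)] (mod int q)" by auto
  assume uq: "u < q"
  have "fixpoint x = u" if "[\<tau> x = (1 - \<sigma> x) * int u] (mod int q)"
  proof -
    have "[(1 - \<sigma> x) * int (fixpoint x) = (1 - \<sigma> x) * int u] (mod int q)"
      using fp that cong_sym cong_trans by blast
    then have "[int (fixpoint x) = int u] (mod int q)" using cong_mult_lcancel cop by blast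
    then show ?thesis using fp uq by (simp add: cong_def)
  qed
  then show "fixpoint x = u \<longleftrightarrow> [\<tau> x = (1 - \<sigma> x) * int u] (mod int q)" using fp by auto
qed

text \<open>Substituting \<open>\<tau> = (1 - \<sigma>) u\<close> for both elements turns the
  adjacency expression into the difference of the fixed points times the two units
  \<open>1 - \<sigma> x\<close> and \<open>1 - \<sigma> y\<close>.\<close>

lemma engel_adjacent_iff_fixpoint:
  assumes x: "x \<in> carrier G - shifts" and y: "y \<in> carrier G - shifts"
  shows "(\<forall>k\<ge>1. iter_commutator G x k y \<noteq> \<one> \<and> iter_commutator G y k x \<noteq> \<one>) \<longleftrightarrow>
    fixpoint x \<noteq> fixpoint y"
proof -
  let ?a = "1 - \<sigma> x" and ?b = "1 - \<sigma> y"
  have "[\<tau> y * ?a - \<tau> x * ?b = ?b * int (fixpoint y) * ?a - ?a * int (fixpoint x) * ?b] (mod int q)"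
    using fixpoint_eq_iff(2)[OF x] fixpoint_eq_iff(2)[OF y] by (intro cong_diff cong_mult cong_refl)
  also have "?b * int (fixpoint y) * ?a - ?a * int (fixpoint x) * ?b =
      ?a * ?b * (int (fixpoint y) - int (fixpoint x))"
    by (simp add: algebra_simps)
  finally have "int q dvd \<tau> y * ?a - \<tau> x * ?b \<longleftrightarrow> int q dvd int (fixpoint y) - int (fixpoint x)"
    using not_dvd_one_minus_\<sigma>[OF x] not_dvd_one_minus_\<sigma>[OF y] q_int(1)
    by (simp add: cong_dvd_iff prime_dvd_mult_iff)
  also have "\<dots> \<longleftrightarrow> fixpoint x = fixpoint y"
    using fixpoint_eq_iff(1)[OF x] fixpoint_eq_iff(1)[OF y]
    by (auto simp: cong_def simp flip: cong_iff_dvd_diff)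
  finally show ?thesis unfolding engel_adjacent_iff[OF x y] by simp
qed

text \<open>For every linear part \<open>s \<noteq> 1\<close> in \<open>S\<close> exactly one map
  fixes \<open>u\<close>, namely \<open>z \<mapsto> s z + (1 - s) u\<close>; this is
  \<open>?g\<close>.\<close>

lemma card_fixpoint:
  assumes u: "u < q"
  shows "card {x \<in> carrier G - shifts. fixpoint x = u} = card (S - {1})"
proof -
  let ?X = "{x \<in> carrier G - shifts. fixpoint x = u}"
  let ?g = "\<lambda>s. (s, (1 - s) * int u mod int q)"
  have fp: "fixpoint x = u \<longleftrightarrow> \<tau> x = (1 - \<sigma> x) * int u mod int q" if "x \<in> carrier G - shifts" for x
    using ranges[of x] that unfolding fixpoint_eq_iff(3)[OF that u] cong_def by simp
  have "\<phi> ` ?X = ?g ` (S - {1})"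
  proof (intro equalityI subsetI)
    fix z assume "z \<in> \<phi> ` ?X"
    then obtain x where x: "x \<in> carrier G - shifts" "fixpoint x = u" "z = \<phi> x" by blast
    have "\<phi> x \<in> S \<times> {0..<int q}" using x(1) img by blast
    then have "\<sigma> x \<in> S - {1}" using x(1) by (auto simp: \<phi>_eq shifts_def)
    moreover have "z = ?g (\<sigma> x)" using x(2,3) fp[OF x(1)] by (simp add: \<phi>_eq)
    ultimately show "z \<in> ?g ` (S - {1})" by blast
  next
    fix z assume "z \<in> ?g ` (S - {1})"
    then obtain s where s: "s \<in> S - {1}" "z = ?g s" by blast
    then have "z \<in> \<phi> ` carrier G" using q_int unfolding img by simp
    then obtain x where x: "x \<in> carrier G" "z = \<phi> x" by blast
    then have "\<sigma> x = s" "\<tau> x = (1 - s) * int u mod int q" using s by (auto simp: \<phi>_eq)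
    then have "x \<in> ?X" using x(1) s fp[of x] by (auto simp: shifts_def)
    then show "z \<in> \<phi> ` ?X" using x(2) by blast
  qed
  moreover have "inj_on \<phi> ?X" by (rule inj_on_subset[OF inj]) auto
  moreover have "inj_on ?g (S - {1})" by (auto simp: inj_on_def)
  ultimately show ?thesis by (metis (no_types, lifting) card_image)
qed

lemma complete_multipartite_engel_graph:
  assumes "2 \<le> card S"
  shows "complete_multipartite (engel_graph G) fixpoint q (card S - 1)"
proof
  have V: "vertices (engel_graph G) = carrier G - shifts"
    by (simp add: engel_graph_def Let_def fitting_subgroup_eq)
  show "edges (engel_graph G) = {{x, y} | x y. x \<in> vertices (engel_graph G) \<and> y \<in> vertices (engel_graph G)
      \<and> fixpoint x \<noteq> fixpoint y}"
    unfolding V using engel_adjacent_iff_fixpoint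
    by (simp add: engel_graph_def Let_def fitting_subgroup_eq) blast
  show "fixpoint v < q" if "v \<in> vertices (engel_graph G)" for v
    using that fixpoint_eq_iff(1) by (simp add: V)
  \<comment> \<open>Infinite sets have \<open>card\<close> 0. Finiteness is what turns
    \<open>card (S - {1})\<close> into \<open>card S - 1\<close>.\<close>
  have "finite S" using assms by (intro card_ge_0_finite) simp
  then show "card {v \<in> vertices (engel_graph G). fixpoint v = u} = card S - 1" if "u < q" for u
    using card_fixpoint[OF that] one_in_S by (simp add: V)
  show "0 < q" "0 < card S - 1" using q_int assms by simp_all
qed

end

theorem theorem8p5:
  fixes p q :: nat and r :: int and G :: "('g, 'm) monoid_scheme" and \<Gamma> :: "'g sgraph"
  assumes "prime p" and "prime q" and "[q = 1] (mod p)"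
    and "[r ^ p = 1] (mod int q)" and "\<not> [r = 1] (mod int q)"
    and "group G" and "G \<cong> F_pq p q r"
  defines "\<Gamma> \<equiv> engel_graph G"
  shows "Spec \<Gamma> =
      replicate_mset (q * (p - 2)) 0 +
      replicate_mset (q - 1) (- (real p - 1)) +
      {# (real p - 1) * (real q - 1) #}
    \<and> L_spec \<Gamma> =
      {# 0 #} +
      replicate_mset (q * (p - 2)) ((real p - 1) * (real q - 1)) +
      replicate_mset (q - 1) (real q * (real p - 1))
    \<and> Q_spec \<Gamma> =
      replicate_mset (q * (p - 2)) ((real p - 1) * (real q - 1)) +
      replicate_mset (q - 1) ((real p - 1) * (real q - 2)) +
      {# 2 * (real p - 1) * (real q - 1) #}
    \<and> energy \<Gamma> = 2 * (real p - 1) * (real q - 1)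
    \<and> laplacian_energy \<Gamma> = 2 * (real p - 1) * (real q - 1)
    \<and> signless_laplacian_energy \<Gamma> = 2 * (real p - 1) * (real q - 1)"
proof -
  obtain \<phi> S where \<phi>: "\<phi> \<in> hom (F_pq p q r) (affine_group (int q))"
    "inj_on \<phi> (carrier (F_pq p q r))"
    "\<phi> ` carrier (F_pq p q r) = S \<times> {0..<int q}" and S: "card S = p" "1 \<in> S"
    by (rule F_pq_embedding[OF assms(1,2,4,5)])
  obtain \<theta> where \<theta>: "\<theta> \<in> hom G (F_pq p q r)" "bij_betw \<theta> (carrier G) (carrier (F_pq p q r))"
    using assms(7) by (auto simp: is_iso_def iso_def)
  have "affine_subgroup G (\<phi> \<circ> \<theta>) q S"
  proof (intro affine_subgroup.intro affine_subgroup_axioms.intro)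
    show "\<phi> \<circ> \<theta> \<in> hom G (affine_group (int q))" using \<theta>(1) \<phi>(1) by (rule hom_compose)
    show "inj_on (\<phi> \<circ> \<theta>) (carrier G)"
      using \<theta>(2) \<phi>(2) by (intro comp_inj_on) (auto simp: bij_betw_def)
    show "(\<phi> \<circ> \<theta>) ` carrier G = S \<times> {0..<int q}"
      using \<theta>(2) \<phi>(3) by (simp only: image_comp[symmetric] bij_betw_def)
  qed (fact assms S)+
  then interpret A: affine_subgroup G "\<phi> \<circ> \<theta>" q S .
  have p2: "2 \<le> p" using assms(1) by (rule prime_ge_2_nat)
  interpret complete_multipartite \<Gamma> A.fixpoint q "p - 1"
    unfolding \<Gamma>_def using A.complete_multipartite_engel_graph p2 by (simp add: S)
  \<comment> \<open>There are \<open>q\<close> parts of size \<open>p - 1\<close>, the number of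
    elements of \<open>S\<close> other than 1. Since \<open>2 \<le> p\<close>, the truncated
    subtractions convert to real ones in exactly the shape of the claim.\<close>
  have "(real q - 1) * real (p - 1) = (real p - 1) * (real q - 1)"
    "(real q - 2) * real (p - 1) = (real p - 1) * (real q - 2)"
    "2 * (real q - 1) * real (p - 1) = 2 * (real p - 1) * (real q - 1)"
    "real (p - 1) = real p - 1" "p - 1 - 1 = p - 2"
    using p2 by (simp_all add: algebra_simps)
  then show ?thesis
    by (simp only: Spec_eq L_spec_eq Q_spec_eq energy_eq laplacian_energy_eq signless_laplacian_energy_eq simp_thms)
qed

end
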